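(* Let $B_0,B\subset\Lambda$ be noise-type Boolean algebras such that $B_0\subset B$. If $B_0$ is atomless, i.e. $\inf_{x\in F}x=0_\Lambda$ for every ultrafilter $F\subset B_0$, then $B_0$ is sufficient in $B$, i.e. $H^{(1)}(B_0)=H^{(1)}(B)$.
   Context: Let $(\Omega,\mathcal F,P)$ be a probability space with $H=L_2(\Omega,\mathcal F,P)$ (real-valued functions) separable. Every $\sigma$-field is assumed to contain all null sets. $\Lambda$ is the set of all sub-$\sigma$-fields of $\mathcal F$, partially ordered by inclusion; it is a complete lattice with $x\wedge y=x\cap y$, $x\vee y=\sigma(x,y)$ (the least $\sigma$-field containing $x$ and $y$), $\inf X=\bigcap_{x\in X}x$, $\sup X=\sigma(\bigcup_{x\in X}x)$ for $X\subset\Lambda$; its greatest element is $1_\Lambda=\mathcal F$ and its least element $0_\Lambda$ is the trivial $\sigma$-field (null sets and their complements). A noise-type Boolean algebra is a subset $B\subset\Lambda$ that is a sublattice (closed under $\wedge,\vee$), is distributive ($x\wedge(y\vee z)=(x\wedge y)\vee(x\wedge z)$ for $x,y,z\in B$), contains $0_\Lambda$ and $1_\Lambda$, is such that every $x\in B$ has a (necessarily unique) complement $x'\in B$ ($x\wedge x'=0_\Lambda$, $x\vee x'=1_\Lambda$), and such that for every $x\in B$ the $\sigma$-fields $x$ and $x'$ are independent. An ultrafilter in a Boolean algebra $B_0$ is a maximal filter, i.e. an upward closed set $F\subset B_0$, closed under $\wedge$, with $0_\Lambda\notin F$, such that for every $x\in B_0$, $x\notin F$ implies $x'\in F$. The infimum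 $\inf_{x\in F}x$ is taken in $\Lambda$. The first chaos space $H^{(1)}(B)$ is the closed linear subspace of $H$ consisting of all $f\in H$ such that $f=\mathbb E(f\mid x)+\mathbb E(f\mid x')$ for all $x\in B$. *)

theory Defs
  imports "HOL-Probability.Probability"
begin

text \<open>
  The elements of \<open>L\<^sub>2\<close> are represented by functions, not by equivalence classes; every identity
  between them is an almost-everywhere identity, and sets such as the first chaos below are closed
  under almost-everywhere equality.
\<close>

definition L2_space :: "'a measure \<Rightarrow> ('a \<Rightarrow> real) set" where
  "L2_space M = {f \<in> borel_measurable M. integrable M (\<lambda>\<omega>. (f \<omega>)\<^sup>2)}"

definition L2_norm :: "'a measure \<Rightarrow> ('a \<Rightarrow> real) \<Rightarrow> real" where
  "L2_norm M f = sqrt (\<integral>\<omega>. (f \<omega>)\<^sup>2 \<partial>M)"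

definition separable_L2 :: "'a measure \<Rightarrow> bool" where
  "separable_L2 M \<longleftrightarrow>
    (\<exists>D. countable D \<and> D \<subseteq> L2_space M \<and>
      (\<forall>f\<in>L2_space M. \<forall>e>0. \<exists>g\<in>D. L2_norm M (\<lambda>\<omega>. f \<omega> - g \<omega>) < e))"

text \<open>
  Sub-$\sigma$-fields are sets of events. The measure \<open>M\<close> need not be complete; if it is, then
  \<open>null_sets M\<close> consists of all negligible sets.
\<close>

definition sub_sigma_fields :: "'a measure \<Rightarrow> 'a set set set" where
  "sub_sigma_fields M =
    {x. sigma_algebra (space M) x \<and> x \<subseteq> sets M \<and> null_sets M \<subseteq> x}"

definition sf_join :: "'a measure \<Rightarrow> 'a set set \<Rightarrow> 'a set set \<Rightarrow> 'a set set" where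
  "sf_join M x y = sigma_sets (space M) (x \<union> y)"

definition trivial_sf :: "'a measure \<Rightarrow> 'a set set" where
  "trivial_sf M = null_sets M \<union> {space M - N | N. N \<in> null_sets M}"

definition is_sf_complement :: "'a measure \<Rightarrow> 'a set set \<Rightarrow> 'a set set \<Rightarrow> bool" where
  "is_sf_complement M x y \<longleftrightarrow> x \<inter> y = trivial_sf M \<and> sf_join M x y = sets M"

text \<open>Complements are not unique in the lattice of all sub-$\sigma$-fields, only inside a given \<open>B\<close>.\<close>

definition sf_complement :: "'a measure \<Rightarrow> 'a set set set \<Rightarrow> 'a set set \<Rightarrow> 'a set set" where
  "sf_complement M B x = (THE y. y \<in> B \<and> is_sf_complement M x y)"

locale noise_type_boolean_algebra = prob_space M
  for M :: "'a measure" +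
  fixes B :: "'a set set set"
  assumes sub_sigma_fields: "B \<subseteq> sub_sigma_fields M"
    and meet_closed: "x \<in> B \<Longrightarrow> y \<in> B \<Longrightarrow> x \<inter> y \<in> B"
    and join_closed: "x \<in> B \<Longrightarrow> y \<in> B \<Longrightarrow> sf_join M x y \<in> B"
    and meet_join_distrib:
      "x \<in> B \<Longrightarrow> y \<in> B \<Longrightarrow> z \<in> B \<Longrightarrow>
        x \<inter> sf_join M y z = sf_join M (x \<inter> y) (x \<inter> z)"
    and trivial_mem: "trivial_sf M \<in> B"
    and full_mem: "sets M \<in> B"
    and complement_exists: "x \<in> B \<Longrightarrow> \<exists>y\<in>B. is_sf_complement M x y"
    and complement_indep: "x \<in> B \<Longrightarrow> indep_set x (sf_complement M B x)"

definition ultrafilter_in :: "'a measure \<Rightarrow> 'a set set set \<Rightarrow> 'a set set set \<Rightarrow> bool" where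
  "ultrafilter_in M B F \<longleftrightarrow>
    F \<subseteq> B \<and>
    (\<forall>x\<in>F. \<forall>y\<in>B. x \<subseteq> y \<longrightarrow> y \<in> F) \<and>
    (\<forall>x\<in>F. \<forall>y\<in>F. x \<inter> y \<in> F) \<and>
    trivial_sf M \<notin> F \<and>
    (\<forall>x\<in>B. x \<notin> F \<longrightarrow> sf_complement M B x \<in> F)"

text \<open>
  An ultrafilter is nonempty, so \<open>\<Inter>F\<close> is the infimum of \<open>F\<close> among the sub-$\sigma$-fields.
\<close>

definition atomless_sf_algebra :: "'a measure \<Rightarrow> 'a set set set \<Rightarrow> bool" where
  "atomless_sf_algebra M B \<longleftrightarrow> (\<forall>F. ultrafilter_in M B F \<longrightarrow> \<Inter>F = trivial_sf M)"

definition sf_cond_exp :: "'a measure \<Rightarrow> 'a set set \<Rightarrow> ('a \<Rightarrow> real) \<Rightarrow> 'a \<Rightarrow> real" where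
  "sf_cond_exp M x f = real_cond_exp M (sigma (space M) x) f"

definition first_chaos :: "'a measure \<Rightarrow> 'a set set set \<Rightarrow> ('a \<Rightarrow> real) set" where
  "first_chaos M B =
    {f \<in> L2_space M. \<forall>x\<in>B.
      AE \<omega> in M. f \<omega> = sf_cond_exp M x f \<omega> + sf_cond_exp M (sf_complement M B x) f \<omega>}"

definition sufficient_in :: "'a measure \<Rightarrow> 'a set set set \<Rightarrow> 'a set set set \<Rightarrow> bool" where
  "sufficient_in M B\<^sub>0 B \<longleftrightarrow> first_chaos M B\<^sub>0 = first_chaos M B"

context noise_type_boolean_algebra
begin

lemma trivial_subset:
  assumes "x \<in> B"
  shows "trivial_sf M \<subseteq> x"
proof -
  interpret x: sigma_algebra "space M" x
    using assms sub_sigma_fields by (auto simp: sub_sigma_fields_def)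
  show ?thesis
    using assms sub_sigma_fields by (auto simp: sub_sigma_fields_def trivial_sf_def)
qed

lemma complement_le:
  assumes "x \<in> B" "y \<in> B" "z \<in> B" "is_sf_complement M x y" "is_sf_complement M x z"
  shows "y \<subseteq> z"
proof -
  have yz: "y \<inter> z \<in> B" using assms meet_closed by auto
  then have sa: "sigma_algebra (space M) (y \<inter> z)" "y \<subseteq> sets M"
    using sub_sigma_fields assms by (auto simp: sub_sigma_fields_def)
  have "y = y \<inter> sf_join M x z"
    using sa assms by (auto simp: is_sf_complement_def)
  also have "\<dots> = sf_join M (y \<inter> x) (y \<inter> z)"
    using assms meet_join_distrib by auto
  also have "\<dots> = sigma_sets (space M) (y \<inter> z)"
    using assms trivial_subset[OF yz]
    by (auto simp: sf_join_def is_sf_complement_def Int_commute Un_absorb1)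
  also have "\<dots> = y \<inter> z"
    using sa by (simp add: sigma_algebra.sigma_sets_eq)
  finally show ?thesis by blast
qed

lemma complement_ex1: "x \<in> B \<Longrightarrow> \<exists>!y. y \<in> B \<and> is_sf_complement M x y"
  using complement_exists complement_le by (blast intro: equalityI)

lemma sf_complement:
  assumes "x \<in> B"
  shows "sf_complement M B x \<in> B" "is_sf_complement M x (sf_complement M B x)"
  using theI'[OF complement_ex1[OF assms]] by (auto simp: sf_complement_def)

lemma ultrafilter_nonempty: "ultrafilter_in M B F \<Longrightarrow> F \<noteq> {}"
  using trivial_mem by (auto simp: ultrafilter_in_def)

end

end

theory Submission
  imports Defs
begin

text \<open>
  Write \<open>h\<^sub>w\<close> for the conditional expectation of \<open>h\<close> given \<open>w\<close>, let \<open>f\<close> be in the first chaos of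
  \<open>B\<^sub>0\<close>, and let \<open>x \<in> B\<close> have complement \<open>x'\<close>. The products \<open>1\<^sub>A 1\<^sub>C\<close> with \<open>A \<in> x\<close> and \<open>C \<in> x'\<close> are total
  in \<open>L\<^sub>2\<close>, so after centring the two factors the identity \<open>f = f\<^sub>x + f\<^sub>x\<^sub>'\<close> amounts to
  \<open>E (f a c) = 0\<close> for bounded centred \<open>a\<close>, \<open>c\<close> that are measurable with respect to \<open>x\<close> and \<open>x'\<close>.

  Split the unit of \<open>B\<^sub>0\<close> into disjoint elements \<open>w\<^sub>1, \<dots>, w\<^sub>n\<close> of \<open>B\<^sub>0\<close>. Membership in the first chaos
  makes \<open>f\<close> the sum of the \<open>f\<^sub>w\<close>. Each \<open>w = w\<^sub>i\<close> is the join of the independent pieces \<open>w \<inter> x\<close> and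
  \<open>w \<inter> x'\<close>, so the conditional expectation of \<open>a c\<close> given \<open>w\<close> factorises as \<open>a\<^sub>w\<^sub>\<inter>\<^sub>x c\<^sub>w\<^sub>\<inter>\<^sub>x\<^sub>'\<close>. If all
  \<open>a\<^sub>w\<^sub>\<inter>\<^sub>x\<close> have norm at most \<open>e\<close>, then
  \<open>\<bar>E (f a c)\<bar> \<le> e \<Sum> (\<parallel>f\<^sub>w\<parallel>\<^sup>2 + \<parallel>c\<^sub>w\<^sub>\<inter>\<^sub>x\<^sub>'\<parallel>\<^sup>2) \<le> e (\<parallel>f\<parallel>\<^sup>2 + \<parallel>c\<parallel>\<^sup>2)\<close>, the last step being
  Bessel's inequality for independent pieces. As \<open>e\<close> is arbitrary, the expectation vanishes. The
  one-piece estimate is \<open>product_pairing_le\<close>.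

  Partitions with small \<open>a\<^sub>w\<^sub>\<inter>\<^sub>x\<close> exist because \<open>B\<^sub>0\<close> is atomless. Along an ultrafilter the
  \<open>a\<^sub>w\<close> converge in \<open>L\<^sub>2\<close> to the conditional expectation given the infimum, which is the constant \<open>0\<close>
  (\<open>sf_cond_exp_filter_small\<close>), so each ultrafilter has a member on which \<open>a\<close> is small; compactness of
  the Stone space of \<open>B\<^sub>0\<close> then gives a finite partition. The formal argument replaces partitions by
  the ideal of those \<open>u \<in> B\<^sub>0\<close> below which the estimate holds: if it were proper, some ultrafilter
  would avoid it (\<open>ultrafilter_avoiding_ideal\<close>), contradicting smallness along that ultrafilter.
\<close>

section \<open>Conditional expectations given sub-sigma-fields\<close>

context prob_space
begin

lemma sigma_sub_sigma_field:
  assumes "x \<in> sub_sigma_fields M"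
  shows "sets (sigma (space M) x) = x" "space (sigma (space M) x) = space M"
    "subalgebra M (sigma (space M) x)"
proof -
  interpret x: sigma_algebra "space M" x
    using assms by (auto simp: sub_sigma_fields_def)
  show *: "sets (sigma (space M) x) = x" "space (sigma (space M) x) = space M"
    by simp_all
  show "subalgebra M (sigma (space M) x)"
    using assms * by (auto simp: sub_sigma_fields_def subalgebra_def)
qed

lemma subalgebra_sub_sigma_field:
  assumes "x \<in> sub_sigma_fields M"
  shows "finite_measure_subalgebra M (sigma (space M) x)"
  using sigma_sub_sigma_field(3)[OF assms]
  by (simp add: finite_measure_subalgebra_def finite_measure_subalgebra_axioms_def
      finite_measure_axioms)

lemma sub_sigma_field_measurable_mono:
  assumes "x \<in> sub_sigma_fields M" "y \<in> sub_sigma_fields M" "x \<subseteq> y"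
    and "f \<in> borel_measurable (sigma (space M) x)"
  shows "f \<in> borel_measurable (sigma (space M) y)"
  using assms sigma_sub_sigma_field[OF assms(1)] sigma_sub_sigma_field[OF assms(2)]
  by (auto simp: measurable_def)

lemma sub_sigma_field_measurable:
  assumes "x \<in> sub_sigma_fields M" "f \<in> borel_measurable (sigma (space M) x)"
  shows "f \<in> borel_measurable M"
  using measurable_from_subalg[OF sigma_sub_sigma_field(3)] assms by blast

lemma sf_cond_exp_measurable [measurable]:
  "sf_cond_exp M x f \<in> borel_measurable (sigma (space M) x)"
  unfolding sf_cond_exp_def by simp

lemma sf_cond_exp_measurable' [measurable]: "sf_cond_exp M x f \<in> borel_measurable M"
  unfolding sf_cond_exp_def by simp

lemma sf_cond_exp_int:
  assumes "x \<in> sub_sigma_fields M" "integrable M f"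
  shows "integrable M (sf_cond_exp M x f)"
    "expectation (sf_cond_exp M x f) = expectation f"
proof -
  interpret finite_measure_subalgebra M "sigma (space M) x"
    by (rule subalgebra_sub_sigma_field[OF assms(1)])
  show "integrable M (sf_cond_exp M x f)"
    "expectation (sf_cond_exp M x f) = expectation f"
    using assms(2) real_cond_exp_int by (auto simp: sf_cond_exp_def)
qed

lemma sf_cond_exp_mult:
  assumes "x \<in> sub_sigma_fields M" "g \<in> borel_measurable (sigma (space M) x)"
    and "f \<in> borel_measurable M" "integrable M (\<lambda>\<omega>. g \<omega> * f \<omega>)"
  shows "integrable M (\<lambda>\<omega>. g \<omega> * sf_cond_exp M x f \<omega>)"
    "expectation (\<lambda>\<omega>. g \<omega> * sf_cond_exp M x f \<omega>) = expectation (\<lambda>\<omega>. g \<omega> * f \<omega>)"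
proof -
  interpret finite_measure_subalgebra M "sigma (space M) x"
    by (rule subalgebra_sub_sigma_field[OF assms(1)])
  show "integrable M (\<lambda>\<omega>. g \<omega> * sf_cond_exp M x f \<omega>)"
    "expectation (\<lambda>\<omega>. g \<omega> * sf_cond_exp M x f \<omega>) = expectation (\<lambda>\<omega>. g \<omega> * f \<omega>)"
    using real_cond_exp_intg[OF assms(4) assms(2,3)] by (auto simp: sf_cond_exp_def)
qed

lemma sf_cond_exp_measurable_eq:
  assumes "x \<in> sub_sigma_fields M" "integrable M f" "f \<in> borel_measurable (sigma (space M) x)"
  shows "AE \<omega> in M. sf_cond_exp M x f \<omega> = f \<omega>"
proof -
  interpret finite_measure_subalgebra M "sigma (space M) x"
    by (rule subalgebra_sub_sigma_field[OF assms(1)])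
  show ?thesis
    using real_cond_exp_F_meas[OF assms(2,3)] by (simp add: sf_cond_exp_def)
qed

lemma sf_cond_exp_tower:
  assumes "x \<in> sub_sigma_fields M" "y \<in> sub_sigma_fields M" "x \<subseteq> y" "integrable M f"
  shows "AE \<omega> in M. sf_cond_exp M x (sf_cond_exp M y f) \<omega> = sf_cond_exp M x f \<omega>"
proof -
  interpret finite_measure_subalgebra M "sigma (space M) x"
    by (rule subalgebra_sub_sigma_field[OF assms(1)])
  have "subalgebra (sigma (space M) y) (sigma (space M) x)"
    using assms sigma_sub_sigma_field by (auto simp: subalgebra_def)
  then show ?thesis
    unfolding sf_cond_exp_def
    using sigma_sub_sigma_field(3)[OF assms(2)] assms(4) by blast
qed

lemma sf_cond_exp_abs_le:
  assumes "x \<in> sub_sigma_fields M" "integrable M f" "AE \<omega> in M. \<bar>f \<omega>\<bar> \<le> c"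
  shows "AE \<omega> in M. \<bar>sf_cond_exp M x f \<omega>\<bar> \<le> c"
proof -
  interpret finite_measure_subalgebra M "sigma (space M) x"
    by (rule subalgebra_sub_sigma_field[OF assms(1)])
  have "AE \<omega> in M. - c \<le> f \<omega>" "AE \<omega> in M. f \<omega> \<le> c"
    using assms(3) by (auto elim: eventually_mono)
  then have "AE \<omega> in M. - c \<le> sf_cond_exp M x f \<omega>" "AE \<omega> in M. sf_cond_exp M x f \<omega> \<le> c"
    using real_cond_exp_ge_c[OF assms(2)] real_cond_exp_le_c[OF assms(2)]
    by (simp_all add: sf_cond_exp_def)
  then show ?thesis by eventually_elim auto
qed

lemma L2_spaceD:
  assumes "f \<in> L2_space M"
  shows "f \<in> borel_measurable M" "integrable M (\<lambda>\<omega>. (f \<omega>)\<^sup>2)" "integrable M f"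
  using assms square_integrable_imp_integrable by (auto simp: L2_space_def)

lemma L2_mult_integrable:
  assumes "f \<in> L2_space M" "g \<in> L2_space M"
  shows "integrable M (\<lambda>\<omega>. f \<omega> * g \<omega>)"
proof (rule Bochner_Integration.integrable_bound)
  show "integrable M (\<lambda>\<omega>. (f \<omega>)\<^sup>2 + (g \<omega>)\<^sup>2)"
    using L2_spaceD assms by auto
  show "(\<lambda>\<omega>. f \<omega> * g \<omega>) \<in> borel_measurable M"
    using L2_spaceD assms by auto
  have "\<bar>a * b\<bar> \<le> a\<^sup>2 + b\<^sup>2" for a b :: real
    using sum_squares_bound[of a b] sum_squares_bound[of a "-b"] zero_le_power2[of a]
      zero_le_power2[of b] by (auto simp: abs_if)
  then show "AE \<omega> in M. norm (f \<omega> * g \<omega>) \<le> norm ((f \<omega>)\<^sup>2 + (g \<omega>)\<^sup>2)"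
    by (intro AE_I2) simp
qed

lemma L2_space_bounded:
  assumes "f \<in> borel_measurable M" "AE \<omega> in M. \<bar>f \<omega>\<bar> \<le> c"
  shows "f \<in> L2_space M"
proof -
  have "AE \<omega> in M. norm ((f \<omega>)\<^sup>2) \<le> c\<^sup>2"
    using assms(2)
  proof eventually_elim
    case (elim \<omega>)
    then have "\<bar>f \<omega>\<bar>\<^sup>2 \<le> c\<^sup>2" by (intro power_mono) auto
    then show ?case by simp
  qed
  then have "integrable M (\<lambda>\<omega>. (f \<omega>)\<^sup>2)"
    using assms(1) by (intro integrable_const_bound[where B="c\<^sup>2"]) auto
  then show ?thesis
    using assms(1) by (simp add: L2_space_def)
qed

lemma L2_space_add:
  assumes "f \<in> L2_space M" "g \<in> L2_space M"
  shows "(\<lambda>\<omega>. f \<omega> + g \<omega>) \<in> L2_space M"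
    "expectation (\<lambda>\<omega>. (f \<omega> + g \<omega>)\<^sup>2)
      = expectation (\<lambda>\<omega>. (f \<omega>)\<^sup>2) + expectation (\<lambda>\<omega>. (g \<omega>)\<^sup>2) + 2 * expectation (\<lambda>\<omega>. f \<omega> * g \<omega>)"
proof -
  note int = L2_spaceD[OF assms(1)] L2_spaceD[OF assms(2)] L2_mult_integrable[OF assms]
  have eq: "(\<lambda>\<omega>. (f \<omega> + g \<omega>)\<^sup>2) = (\<lambda>\<omega>. (f \<omega>)\<^sup>2 + (g \<omega>)\<^sup>2 + 2 * (f \<omega> * g \<omega>))"
    by (auto simp: power2_sum)
  show "(\<lambda>\<omega>. f \<omega> + g \<omega>) \<in> L2_space M"
    unfolding L2_space_def using int by (auto simp: eq)
  show "expectation (\<lambda>\<omega>. (f \<omega> + g \<omega>)\<^sup>2)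
      = expectation (\<lambda>\<omega>. (f \<omega>)\<^sup>2) + expectation (\<lambda>\<omega>. (g \<omega>)\<^sup>2) + 2 * expectation (\<lambda>\<omega>. f \<omega> * g \<omega>)"
    unfolding eq using int by simp
qed

lemma L2_space_cmult:
  assumes "f \<in> L2_space M"
  shows "(\<lambda>\<omega>. c * f \<omega>) \<in> L2_space M"
  using assms by (auto simp: L2_space_def power_mult_distrib)

lemma L2_space_diff:
  assumes "f \<in> L2_space M" "g \<in> L2_space M"
  shows "(\<lambda>\<omega>. f \<omega> - g \<omega>) \<in> L2_space M"
    "expectation (\<lambda>\<omega>. (f \<omega> - g \<omega>)\<^sup>2)
      = expectation (\<lambda>\<omega>. (f \<omega>)\<^sup>2) + expectation (\<lambda>\<omega>. (g \<omega>)\<^sup>2) - 2 * expectation (\<lambda>\<omega>. f \<omega> * g \<omega>)"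
  using L2_space_add[OF assms(1) L2_space_cmult[OF assms(2), of "-1"]]
  by (simp_all add: power_mult_distrib)

lemma sf_cond_exp_L2:
  assumes "x \<in> sub_sigma_fields M" "f \<in> L2_space M"
  shows "sf_cond_exp M x f \<in> L2_space M"
proof -
  interpret finite_measure_subalgebra M "sigma (space M) x"
    by (rule subalgebra_sub_sigma_field[OF assms(1)])
  have "integrable M (\<lambda>\<omega>. (real_cond_exp M (sigma (space M) x) f \<omega>)\<^sup>2)"
    by (rule integrable_convex_cond_exp[where I=UNIV])
      (use L2_spaceD[OF assms(2)] in \<open>auto intro: convex_power2\<close>)
  then show ?thesis
    by (auto simp: L2_space_def sf_cond_exp_def)
qed

lemma sf_cond_exp_orthogonal:
  assumes "x \<in> sub_sigma_fields M" "f \<in> L2_space M"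
    and "g \<in> L2_space M" "g \<in> borel_measurable (sigma (space M) x)"
  shows "expectation (\<lambda>\<omega>. g \<omega> * sf_cond_exp M x f \<omega>) = expectation (\<lambda>\<omega>. g \<omega> * f \<omega>)"
  using sf_cond_exp_mult(2)[OF assms(1,4)] L2_spaceD[OF assms(2)] L2_mult_integrable[OF assms(3,2)]
  by blast

lemma sf_cond_exp_pythagoras:
  assumes "x \<in> sub_sigma_fields M" "f \<in> L2_space M"
  shows "expectation (\<lambda>\<omega>. (f \<omega> - sf_cond_exp M x f \<omega>)\<^sup>2)
    = expectation (\<lambda>\<omega>. (f \<omega>)\<^sup>2) - expectation (\<lambda>\<omega>. (sf_cond_exp M x f \<omega>)\<^sup>2)"
proof -
  let ?Q = "sf_cond_exp M x f"
  have "expectation (\<lambda>\<omega>. f \<omega> * ?Q \<omega>) = expectation (\<lambda>\<omega>. (?Q \<omega>)\<^sup>2)"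
    using sf_cond_exp_orthogonal[OF assms sf_cond_exp_L2[OF assms] sf_cond_exp_measurable]
    by (simp add: power2_eq_square mult.commute)
  then show ?thesis
    using L2_space_diff(2)[OF assms(2) sf_cond_exp_L2[OF assms]] by simp
qed

lemma sf_cond_exp_pythagoras_nested:
  assumes x: "x \<in> sub_sigma_fields M" and y: "y \<in> sub_sigma_fields M" and "x \<subseteq> y"
    and f: "f \<in> L2_space M"
  shows "expectation (\<lambda>\<omega>. (sf_cond_exp M y f \<omega> - sf_cond_exp M x f \<omega>)\<^sup>2)
    = expectation (\<lambda>\<omega>. (sf_cond_exp M y f \<omega>)\<^sup>2) - expectation (\<lambda>\<omega>. (sf_cond_exp M x f \<omega>)\<^sup>2)"
proof -
  let ?Qx = "sf_cond_exp M x" and ?Qy = "sf_cond_exp M y"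
  have tower: "AE \<omega> in M. ?Qx (?Qy f) \<omega> = ?Qx f \<omega>"
    using sf_cond_exp_tower[OF x y \<open>x \<subseteq> y\<close>] L2_spaceD[OF f] by blast
  have "expectation (\<lambda>\<omega>. (?Qy f \<omega> - ?Qx f \<omega>)\<^sup>2)
      = expectation (\<lambda>\<omega>. (?Qy f \<omega> - ?Qx (?Qy f) \<omega>)\<^sup>2)"
    using tower by (intro integral_cong_AE) (auto elim: eventually_mono)
  also have "\<dots> = expectation (\<lambda>\<omega>. (?Qy f \<omega>)\<^sup>2) - expectation (\<lambda>\<omega>. (?Qx (?Qy f) \<omega>)\<^sup>2)"
    by (rule sf_cond_exp_pythagoras[OF x sf_cond_exp_L2[OF y f]])
  also have "expectation (\<lambda>\<omega>. (?Qx (?Qy f) \<omega>)\<^sup>2) = expectation (\<lambda>\<omega>. (?Qx f \<omega>)\<^sup>2)"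
    using tower by (intro integral_cong_AE) (auto elim: eventually_mono)
  finally show ?thesis .
qed

lemma sf_cond_exp_norm_mono:
  assumes "x \<in> sub_sigma_fields M" "y \<in> sub_sigma_fields M" "x \<subseteq> y" "f \<in> L2_space M"
  shows "expectation (\<lambda>\<omega>. (sf_cond_exp M x f \<omega>)\<^sup>2) \<le> expectation (\<lambda>\<omega>. (sf_cond_exp M y f \<omega>)\<^sup>2)"
proof -
  have "0 \<le> expectation (\<lambda>\<omega>. (sf_cond_exp M y f \<omega> - sf_cond_exp M x f \<omega>)\<^sup>2)"
    by simp
  then show ?thesis
    using sf_cond_exp_pythagoras_nested[OF assms] by simp
qed

section \<open>Independent sub-sigma-fields and their join\<close>

lemma indep_sf_mono:
  assumes "indep_set x y" "u \<subseteq> x" "v \<subseteq> y"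
  shows "indep_set u v"
  unfolding indep_set_def
  by (rule indep_sets_mono_sets[OF assms(1)[unfolded indep_set_def]])
    (use assms in \<open>auto split: bool.splits\<close>)

lemma indep_sf_expectation:
  fixes f g :: "'a \<Rightarrow> real"
  assumes x: "x \<in> sub_sigma_fields M" and y: "y \<in> sub_sigma_fields M" and ind: "indep_set x y"
    and f: "integrable M f" "f \<in> borel_measurable (sigma (space M) x)"
    and g: "integrable M g" "g \<in> borel_measurable (sigma (space M) y)"
  shows "integrable M (\<lambda>\<omega>. f \<omega> * g \<omega>)"
    "expectation (\<lambda>\<omega>. f \<omega> * g \<omega>) = expectation f * expectation g"
proof -
  have sub: "sigma_sets (space M) {h -` A \<inter> space M | A. A \<in> sets borel} \<subseteq> z"
    if "z \<in> sub_sigma_fields M" "h \<in> borel_measurable (sigma (space M) z)"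
    for z and h :: "'a \<Rightarrow> real"
  proof -
    interpret z: sigma_algebra "space M" z
      using that by (auto simp: sub_sigma_fields_def)
    show ?thesis
      using that sigma_sub_sigma_field[OF that(1)]
      by (intro z.sigma_sets_subset) (auto simp: measurable_def)
  qed
  have "indep_var borel f borel g"
    unfolding indep_var_eq
    using f g indep_sf_mono[OF ind sub[OF x f(2)] sub[OF y g(2)]] by auto
  then show "integrable M (\<lambda>\<omega>. f \<omega> * g \<omega>)"
    "expectation (\<lambda>\<omega>. f \<omega> * g \<omega>) = expectation f * expectation g"
    using f g indep_var_integrable indep_var_lebesgue_integral by auto
qed

lemma sf_join_eq_sigma_sets_Int:
  assumes "x \<in> sub_sigma_fields M" "y \<in> sub_sigma_fields M"
  shows "sf_join M x y = sigma_sets (space M) {A \<inter> C | A C. A \<in> x \<and> C \<in> y}"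
proof -
  interpret x: sigma_algebra "space M" x
    using assms by (auto simp: sub_sigma_fields_def)
  interpret y: sigma_algebra "space M" y
    using assms by (auto simp: sub_sigma_fields_def)
  have "A \<in> {A \<inter> C | A C. A \<in> x \<and> C \<in> y}" if "A \<in> x \<union> y" for A
  proof -
    have "A = A \<inter> space M" "A = space M \<inter> A"
      using that x.sets_into_space y.sets_into_space by auto
    with that x.top y.top show ?thesis by blast
  qed
  moreover have "A \<inter> C \<in> sigma_sets (space M) (x \<union> y)" if "A \<in> x" "C \<in> y" for A C
  proof -
    interpret xy: sigma_algebra "space M" "sigma_sets (space M) (x \<union> y)"
      using x.sets_into_space y.sets_into_space by (intro sigma_algebra_sigma_sets) auto
    show ?thesis
      using that by (intro xy.Int) auto
  qed
  ultimately show ?thesis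
    unfolding sf_join_def by (intro sigma_sets_eqI) auto
qed

text \<open>
  The intersections \<open>A \<inter> C\<close> with \<open>A \<in> x\<close>, \<open>C \<in> y\<close> form a \<open>\<pi>\<close>-system generating the join, so they
  suffice to identify a conditional expectation.
\<close>

lemma sf_cond_exp_joinI:
  assumes x: "x \<in> sub_sigma_fields M" and y: "y \<in> sub_sigma_fields M"
    and z: "sf_join M x y \<in> sub_sigma_fields M"
    and h: "integrable M h" and g: "integrable M g"
    and gz: "g \<in> borel_measurable (sigma (space M) (sf_join M x y))"
    and eq: "\<And>A C. A \<in> x \<Longrightarrow> C \<in> y \<Longrightarrow>
      expectation (\<lambda>\<omega>. h \<omega> * (indicator A \<omega> * indicator C \<omega>))
        = expectation (\<lambda>\<omega>. g \<omega> * (indicator A \<omega> * indicator C \<omega>))"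
  shows "AE \<omega> in M. sf_cond_exp M (sf_join M x y) h \<omega> = g \<omega>"
proof -
  let ?z = "sf_join M x y" and ?G = "{A \<inter> C | A C. A \<in> x \<and> C \<in> y}"
  interpret finite_measure_subalgebra M "sigma (space M) ?z"
    by (rule subalgebra_sub_sigma_field[OF z])
  interpret x: sigma_algebra "space M" x
    using x by (auto simp: sub_sigma_fields_def)
  interpret y: sigma_algebra "space M" y
    using y by (auto simp: sub_sigma_fields_def)
  have zM: "?z \<subseteq> sets M"
    using z by (auto simp: sub_sigma_fields_def)
  have stable: "Int_stable ?G"
  proof (rule Int_stableI)
    fix D E assume "D \<in> ?G" "E \<in> ?G"
    then obtain A C A' C' where "D = A \<inter> C" "E = A' \<inter> C'" "A \<in> x" "A' \<in> x" "C \<in> y" "C' \<in> y"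
      by auto
    then have "D \<inter> E = (A \<inter> A') \<inter> (C \<inter> C')" "A \<inter> A' \<in> x" "C \<inter> C' \<in> y"
      by auto
    then show "D \<inter> E \<in> ?G" by blast
  qed
  have total: "(LINT \<omega>:space M|M. h \<omega>) = (LINT \<omega>:space M|M. g \<omega>)"
    using eq[OF x.top y.top]
    by (simp add: set_lebesgue_integral_def mult.commute cong: Bochner_Integration.integral_cong)
  have int_set: "set_integrable M D f" if "D \<in> ?z" "integrable M f" for D and f :: "'a \<Rightarrow> real"
    using that zM unfolding set_integrable_def by (intro integrable_mult_indicator) auto
  have "(LINT \<omega>:D|M. h \<omega>) = (LINT \<omega>:D|M. g \<omega>)" if "D \<in> ?z" for D
  proof -
    have "?G \<subseteq> Pow (space M)"
      using x.sets_into_space by auto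
    from stable this that[unfolded sf_join_eq_sigma_sets_Int[OF x y]] show ?thesis
    proof (induction D rule: sigma_sets_induct_disjoint)
      case (basic D)
      then obtain A C where "D = A \<inter> C" "A \<in> x" "C \<in> y" by auto
      then show ?case
        using eq by (simp add: set_lebesgue_integral_def indicator_inter_arith mult.commute)
    next
      case empty
      show ?case by (simp add: set_lebesgue_integral_def)
    next
      case (compl D)
      then have D: "D \<in> ?z" "space M - D \<in> ?z"
        unfolding sf_join_eq_sigma_sets_Int[OF x y] by (auto intro: sigma_sets.Compl)
      have split: "(LINT \<omega>:space M|M. f \<omega>) = (LINT \<omega>:D|M. f \<omega>) + (LINT \<omega>:space M - D|M. f \<omega>)"
        if "integrable M f" for f :: "'a \<Rightarrow> real"
        using set_integral_Un[of D "space M - D" M f] D[THEN int_set[OF _ that]] D(1) zM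
          sets.sets_into_space[of D M] by (auto simp: Un_absorb1)
      show ?case
        using split[OF h] split[OF g] total compl by simp
    next
      case (union D)
      then have D: "range D \<subseteq> ?z" "\<Union>(range D) \<in> ?z"
        unfolding sf_join_eq_sigma_sets_Int[OF x y] by (auto intro: sigma_sets.Union)
      have "(LINT \<omega>:\<Union>(range D)|M. f \<omega>) = (\<Sum>i. LINT \<omega>:D i|M. f \<omega>)"
        if "integrable M f" for f :: "'a \<Rightarrow> real"
        using D zM union(1) int_set[OF D(2) that]
        by (intro lebesgue_integral_countable_add) (auto simp: disjoint_family_on_def)
      with h g union show ?case by simp
    qed
  qed
  then show ?thesis
    unfolding sf_cond_exp_def
    by (intro real_cond_exp_charact h g gz) (simp add: sigma_sub_sigma_field(1)[OF z])
qed

lemma indicator_sub_sigma_field: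
  assumes "x \<in> sub_sigma_fields M" "A \<in> x"
  shows "(indicator A :: 'a \<Rightarrow> real) \<in> borel_measurable (sigma (space M) x)" "A \<in> sets M"
    "integrable M (indicator A :: 'a \<Rightarrow> real)" "expectation (indicator A) = prob A"
proof -
  show "A \<in> sets M"
    using assms by (auto simp: sub_sigma_fields_def)
  then show "integrable M (indicator A :: 'a \<Rightarrow> real)" "expectation (indicator A) = prob A"
    using sets.sets_into_space[of A M] by (auto simp: Int_absorb2 less_top[symmetric])
  show "(indicator A :: 'a \<Rightarrow> real) \<in> borel_measurable (sigma (space M) x)"
    using assms sigma_sub_sigma_field(1)[OF assms(1)] by (intro borel_measurable_indicator) simp
qed

lemma indep_sf_expectation_indicators:
  fixes f g :: "'a \<Rightarrow> real"
  assumes x: "x \<in> sub_sigma_fields M" and y: "y \<in> sub_sigma_fields M" and ind: "indep_set x y"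
    and f: "integrable M f" "f \<in> borel_measurable (sigma (space M) x)"
    and g: "integrable M g" "g \<in> borel_measurable (sigma (space M) y)"
    and A: "A \<in> x" and C: "C \<in> y"
  shows "integrable M (\<lambda>\<omega>. f \<omega> * g \<omega> * (indicator A \<omega> * indicator C \<omega>))"
    "expectation (\<lambda>\<omega>. f \<omega> * g \<omega> * (indicator A \<omega> * indicator C \<omega>))
      = expectation (\<lambda>\<omega>. f \<omega> * indicator A \<omega>) * expectation (\<lambda>\<omega>. g \<omega> * indicator C \<omega>)"
proof -
  note iA = indicator_sub_sigma_field[OF x A] and iC = indicator_sub_sigma_field[OF y C]
  have fA: "integrable M (\<lambda>\<omega>. f \<omega> * indicator A \<omega>)"
      "(\<lambda>\<omega>. f \<omega> * indicator A \<omega>) \<in> borel_measurable (sigma (space M) x)"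
    using iA f by (auto intro: integrable_real_mult_indicator)
  have gC: "integrable M (\<lambda>\<omega>. g \<omega> * indicator C \<omega>)"
      "(\<lambda>\<omega>. g \<omega> * indicator C \<omega>) \<in> borel_measurable (sigma (space M) y)"
    using iC g by (auto intro: integrable_real_mult_indicator)
  have eq: "(\<lambda>\<omega>. f \<omega> * g \<omega> * (indicator A \<omega> * indicator C \<omega>))
      = (\<lambda>\<omega>. (f \<omega> * indicator A \<omega>) * (g \<omega> * indicator C \<omega>))"
    by (auto simp: mult_ac)
  show "integrable M (\<lambda>\<omega>. f \<omega> * g \<omega> * (indicator A \<omega> * indicator C \<omega>))"
    "expectation (\<lambda>\<omega>. f \<omega> * g \<omega> * (indicator A \<omega> * indicator C \<omega>))
      = expectation (\<lambda>\<omega>. f \<omega> * indicator A \<omega>) * expectation (\<lambda>\<omega>. g \<omega> * indicator C \<omega>)"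
    unfolding eq using indep_sf_expectation[OF x y ind fA gC] by auto
qed

lemma indep_sf_sym: "indep_set x y \<Longrightarrow> indep_set y x"
  unfolding indep_sets2_eq by (metis Int_commute mult.commute)

text \<open>
  Since \<open>1\<^sub>C\<close> is independent of \<open>x\<close>, it splits off from the conditional expectation given \<open>x\<close>; the
  remaining factor \<open>1\<^sub>A\<close> is absorbed because \<open>A \<in> x\<close>.
\<close>

lemma sf_cond_exp_indicators:
  assumes x: "x \<in> sub_sigma_fields M" and y: "y \<in> sub_sigma_fields M" and ind: "indep_set x y"
    and h: "integrable M h" and A: "A \<in> x" and C: "C \<in> y"
  shows "integrable M (\<lambda>\<omega>. sf_cond_exp M x h \<omega> * (indicator A \<omega> * indicator C \<omega>))"
    "expectation (\<lambda>\<omega>. sf_cond_exp M x h \<omega> * (indicator A \<omega> * indicator C \<omega>))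
      = expectation (\<lambda>\<omega>. h \<omega> * indicator A \<omega>) * prob C"
proof -
  note iA = indicator_sub_sigma_field[OF x A] and iC = indicator_sub_sigma_field[OF y C]
  have 1: "expectation (\<lambda>\<omega>. sf_cond_exp M x h \<omega> * indicator A \<omega>)
      = expectation (\<lambda>\<omega>. h \<omega> * indicator A \<omega>)"
    using sf_cond_exp_mult(2)[OF x iA(1)] h iA(2) integrable_real_mult_indicator[OF iA(2) h]
    by (simp add: mult.commute)
  have 2: "expectation (\<lambda>\<omega>. 1 * indicator C \<omega>) = prob C"
    using iC by simp
  note * = indep_sf_expectation_indicators[OF x y ind sf_cond_exp_int(1)[OF x h]
      sf_cond_exp_measurable, of "\<lambda>_. 1", OF _ _ A C, unfolded 1 2]
  show "integrable M (\<lambda>\<omega>. sf_cond_exp M x h \<omega> * (indicator A \<omega> * indicator C \<omega>))"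
    "expectation (\<lambda>\<omega>. sf_cond_exp M x h \<omega> * (indicator A \<omega> * indicator C \<omega>))
      = expectation (\<lambda>\<omega>. h \<omega> * indicator A \<omega>) * prob C"
    using * by auto
qed

text \<open>
  The hypothesis on \<open>h\<close> says that its centred pairing with every product \<open>1\<^sub>A 1\<^sub>C\<close> vanishes, in a form
  that is easy to verify; it forces \<open>E h = 0\<close> (take both events to be the whole space). It serves
  twice: for pieces of an element of a Boolean algebra, and for an element together with its complement.
\<close>

lemma sf_cond_exp_add_joinI:
  assumes x: "x \<in> sub_sigma_fields M" and y: "y \<in> sub_sigma_fields M"
    and z: "sf_join M x y \<in> sub_sigma_fields M" and ind: "indep_set x y" and h: "integrable M h"
    and eq: "\<And>A C. A \<in> x \<Longrightarrow> C \<in> y \<Longrightarrow>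
      expectation (\<lambda>\<omega>. h \<omega> * (indicator A \<omega> * indicator C \<omega>))
        = expectation (\<lambda>\<omega>. h \<omega> * indicator A \<omega>) * prob C
          + expectation (\<lambda>\<omega>. h \<omega> * indicator C \<omega>) * prob A"
  shows "AE \<omega> in M. sf_cond_exp M (sf_join M x y) h \<omega> = sf_cond_exp M x h \<omega> + sf_cond_exp M y h \<omega>"
proof (rule sf_cond_exp_joinI[OF x y z h])
  have sub: "x \<subseteq> sf_join M x y" "y \<subseteq> sf_join M x y"
    by (auto simp: sf_join_def)
  show "integrable M (\<lambda>\<omega>. sf_cond_exp M x h \<omega> + sf_cond_exp M y h \<omega>)"
    using sf_cond_exp_int(1)[OF x h] sf_cond_exp_int(1)[OF y h] by simp
  show "(\<lambda>\<omega>. sf_cond_exp M x h \<omega> + sf_cond_exp M y h \<omega>)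
      \<in> borel_measurable (sigma (space M) (sf_join M x y))"
    by (intro borel_measurable_add sub_sigma_field_measurable_mono[OF x z sub(1)]
        sub_sigma_field_measurable_mono[OF y z sub(2)] sf_cond_exp_measurable)
  fix A C assume A: "A \<in> x" and C: "C \<in> y"
  have "expectation (\<lambda>\<omega>. (sf_cond_exp M x h \<omega> + sf_cond_exp M y h \<omega>) * (indicator A \<omega> * indicator C \<omega>))
      = expectation (\<lambda>\<omega>. h \<omega> * indicator A \<omega>) * prob C
          + expectation (\<lambda>\<omega>. h \<omega> * indicator C \<omega>) * prob A"
    using sf_cond_exp_indicators[OF x y ind h A C]
      sf_cond_exp_indicators[OF y x indep_sf_sym[OF ind] h C A]
    by (simp add: distrib_right mult.commute[of "indicator C _"])
  then show "expectation (\<lambda>\<omega>. h \<omega> * (indicator A \<omega> * indicator C \<omega>))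
      = expectation (\<lambda>\<omega>. (sf_cond_exp M x h \<omega> + sf_cond_exp M y h \<omega>) * (indicator A \<omega> * indicator C \<omega>))"
    using eq[OF A C] by simp
qed

text \<open>
  For centred \<open>h\<close> the projections to independent sub-sigma-fields are orthogonal, so this is Bessel's
  inequality for the projection of \<open>h\<close> to \<open>w\<close>.
\<close>

lemma sf_cond_exp_bessel:
  assumes x: "x \<in> sub_sigma_fields M" and y: "y \<in> sub_sigma_fields M"
    and w: "w \<in> sub_sigma_fields M" and sub: "x \<subseteq> w" "y \<subseteq> w" and ind: "indep_set x y"
    and h: "h \<in> L2_space M" and zero: "expectation h = 0"
  shows "expectation (\<lambda>\<omega>. (sf_cond_exp M x h \<omega>)\<^sup>2) + expectation (\<lambda>\<omega>. (sf_cond_exp M y h \<omega>)\<^sup>2)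
    \<le> expectation (\<lambda>\<omega>. (sf_cond_exp M w h \<omega>)\<^sup>2)"
proof -
  let ?X = "sf_cond_exp M x h" and ?Y = "sf_cond_exp M y h" and ?W = "sf_cond_exp M w h"
  note L2 = sf_cond_exp_L2[OF x h] sf_cond_exp_L2[OF y h] sf_cond_exp_L2[OF w h]
  have hint: "integrable M h" using L2_spaceD[OF h] by auto
  have inner: "expectation (\<lambda>\<omega>. sf_cond_exp M v h \<omega> * ?W \<omega>)
      = expectation (\<lambda>\<omega>. (sf_cond_exp M v h \<omega>)\<^sup>2)"
    if v: "v \<in> sub_sigma_fields M" "v \<subseteq> w" for v
  proof -
    have "expectation (\<lambda>\<omega>. sf_cond_exp M v h \<omega> * ?W \<omega>)
        = expectation (\<lambda>\<omega>. sf_cond_exp M v h \<omega> * h \<omega>)"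
      by (rule sf_cond_exp_orthogonal[OF w h sf_cond_exp_L2[OF v(1) h]
            sub_sigma_field_measurable_mono[OF v(1) w v(2) sf_cond_exp_measurable]])
    also have "\<dots> = expectation (\<lambda>\<omega>. sf_cond_exp M v h \<omega> * sf_cond_exp M v h \<omega>)"
      by (rule sf_cond_exp_orthogonal[OF v(1) h sf_cond_exp_L2[OF v(1) h]
            sf_cond_exp_measurable, symmetric])
    finally show ?thesis by (simp add: power2_eq_square)
  qed
  have XY: "expectation (\<lambda>\<omega>. ?X \<omega> * ?Y \<omega>) = 0"
    using indep_sf_expectation(2)[OF x y ind sf_cond_exp_int(1)[OF x hint] sf_cond_exp_measurable
        sf_cond_exp_int(1)[OF y hint] sf_cond_exp_measurable] sf_cond_exp_int(2)[OF x hint] zero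
    by simp
  have "0 \<le> expectation (\<lambda>\<omega>. (?W \<omega> - (?X \<omega> + ?Y \<omega>))\<^sup>2)"
    by simp
  also have "\<dots> = expectation (\<lambda>\<omega>. (?W \<omega>)\<^sup>2) + expectation (\<lambda>\<omega>. (?X \<omega> + ?Y \<omega>)\<^sup>2)
      - 2 * expectation (\<lambda>\<omega>. ?W \<omega> * (?X \<omega> + ?Y \<omega>))"
    by (rule L2_space_diff(2)[OF L2(3) L2_space_add(1)[OF L2(1,2)]])
  also have "expectation (\<lambda>\<omega>. ?W \<omega> * (?X \<omega> + ?Y \<omega>))
      = expectation (\<lambda>\<omega>. (?X \<omega>)\<^sup>2) + expectation (\<lambda>\<omega>. (?Y \<omega>)\<^sup>2)"
    using inner[OF x sub(1)] inner[OF y sub(2)] L2_mult_integrable[OF L2(3,1)]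
      L2_mult_integrable[OF L2(3,2)] by (simp add: distrib_left mult.commute)
  also have "expectation (\<lambda>\<omega>. (?X \<omega> + ?Y \<omega>)\<^sup>2)
      = expectation (\<lambda>\<omega>. (?X \<omega>)\<^sup>2) + expectation (\<lambda>\<omega>. (?Y \<omega>)\<^sup>2)"
    using L2_space_add(2)[OF L2(1,2)] XY by simp
  finally show ?thesis by simp
qed

section \<open>Conditional expectations along a filter of sub-sigma-fields\<close>

text \<open>
  Sub-sigma-fields contain the null sets, so membership of an event depends only on its almost-everywhere
  class. This is what lets an almost-everywhere limit be measurable with respect to many
  sub-sigma-fields at once.
\<close>

lemma sub_sigma_field_AE_eq:
  assumes v: "v \<in> sub_sigma_fields M" and A: "A \<in> sets M" and A': "A' \<in> v"
    and eq: "AE \<omega> in M. \<omega> \<in> A \<longleftrightarrow> \<omega> \<in> A'"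
  shows "A \<in> v"
proof -
  interpret v: sigma_algebra "space M" v
    using v by (auto simp: sub_sigma_fields_def)
  have A'M: "A' \<in> sets M" using v A' by (auto simp: sub_sigma_fields_def)
  have "A' - A \<in> null_sets M" "A - A' \<in> null_sets M"
    using A A'M eq by (auto simp: AE_iff_null_sets elim: eventually_mono)
  then have "A' - A \<in> v" "A - A' \<in> v"
    using v by (auto simp: sub_sigma_fields_def)
  then have "(A' - (A' - A)) \<union> (A - A') \<in> v"
    using A' by auto
  moreover have "(A' - (A' - A)) \<union> (A - A') = A" by auto
  ultimately show ?thesis by simp
qed

text \<open>
  If the event where \<open>d\<close> is positive has probability \<open>0\<close> or \<open>1\<close>, then \<open>d\<close> has a constant sign, and a
  centred variable of constant sign vanishes.
\<close>

lemma AE_zero_of_trivial: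
  fixes d :: "'a \<Rightarrow> real"
  assumes d: "integrable M d" and zero: "expectation d = 0"
    and triv: "{\<omega> \<in> space M. 0 < d \<omega>} \<in> trivial_sf M"
  shows "AE \<omega> in M. d \<omega> = 0"
proof -
  let ?D = "{\<omega> \<in> space M. 0 < d \<omega>}"
  consider "?D \<in> null_sets M" | N where "N \<in> null_sets M" "?D = space M - N"
    using triv by (auto simp: trivial_sf_def)
  then have "(AE \<omega> in M. d \<omega> \<le> 0) \<or> (AE \<omega> in M. 0 \<le> d \<omega>)"
  proof cases
    case 1
    then have "AE \<omega> in M. \<omega> \<notin> ?D" by (rule AE_not_in)
    then have "AE \<omega> in M. d \<omega> \<le> 0" using AE_space by eventually_elim auto
    then show ?thesis ..
  next
    case 2
    then have "AE \<omega> in M. \<omega> \<notin> N" by (intro AE_not_in)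
    then have "AE \<omega> in M. 0 \<le> d \<omega>" using AE_space 
    proof eventually_elim
      case (elim \<omega>)
      then have "\<omega> \<in> ?D" using 2(2) by blast
      then show ?case by simp
    qed
    then show ?thesis ..
  qed
  then show ?thesis
  proof
    assume "AE \<omega> in M. d \<omega> \<le> 0"
    then show ?thesis
      using integral_nonneg_eq_0_iff_AE[where f="\<lambda>\<omega>. - d \<omega>"] d zero by simp
  next
    assume "AE \<omega> in M. 0 \<le> d \<omega>"
    then show ?thesis
      using integral_nonneg_eq_0_iff_AE[where f=d] d zero by simp
  qed
qed

lemma expectation_abs_le_sqrt:
  assumes "h \<in> L2_space M"
  shows "expectation (\<lambda>\<omega>. \<bar>h \<omega>\<bar>) \<le> sqrt (expectation (\<lambda>\<omega>. (h \<omega>)\<^sup>2))"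
proof -
  have "0 \<le> variance (\<lambda>\<omega>. \<bar>h \<omega>\<bar>)" by simp
  also have "\<dots> = expectation (\<lambda>\<omega>. \<bar>h \<omega>\<bar>\<^sup>2) - (expectation (\<lambda>\<omega>. \<bar>h \<omega>\<bar>))\<^sup>2"
    using L2_spaceD[OF assms] by (intro variance_eq) auto
  finally show ?thesis by (intro real_le_rsqrt) simp
qed

text \<open>
  The sum of the \<open>L\<^sub>1\<close> norms is at most \<open>\<Sum> (1/2)\<^sup>n\<close>, hence finite.
\<close>

lemma AE_summable_of_L2_geometric:
  fixes h :: "nat \<Rightarrow> 'a \<Rightarrow> real"
  assumes h: "\<And>n. h n \<in> L2_space M"
    and bound: "\<And>n. expectation (\<lambda>\<omega>. (h n \<omega>)\<^sup>2) \<le> (1/4) ^ n"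
  shows "AE \<omega> in M. summable (\<lambda>n. h n \<omega>)"
proof -
  have meas [measurable]: "h n \<in> borel_measurable M" for n
    using L2_spaceD[OF h] by auto
  have L1: "(\<integral>\<^sup>+\<omega>. ennreal \<bar>h n \<omega>\<bar> \<partial>M) \<le> ennreal ((1/2) ^ n)" for n
  proof -
    have "expectation (\<lambda>\<omega>. \<bar>h n \<omega>\<bar>) \<le> sqrt (expectation (\<lambda>\<omega>. (h n \<omega>)\<^sup>2))"
      by (rule expectation_abs_le_sqrt[OF h])
    also have "\<dots> \<le> sqrt ((1/4) ^ n)"
      using bound by simp
    also have "\<dots> = (1/2) ^ n"
      by (simp add: real_sqrt_power real_sqrt_divide)
    finally show ?thesis
      using L2_spaceD[OF h] by (subst nn_integral_eq_integral) (auto intro: ennreal_leI)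
  qed
  have "(\<integral>\<^sup>+\<omega>. (\<Sum>n. ennreal \<bar>h n \<omega>\<bar>) \<partial>M) = (\<Sum>n. \<integral>\<^sup>+\<omega>. ennreal \<bar>h n \<omega>\<bar> \<partial>M)"
    by (rule nn_integral_suminf) simp
  also have "\<dots> \<le> (\<Sum>n. ennreal ((1/2) ^ n))"
    by (intro suminf_le L1) auto
  also have "\<dots> = ennreal (\<Sum>n. (1/2) ^ n)"
    by (intro suminf_ennreal2) (auto intro: summable_geometric)
  also have "\<dots> < \<infinity>" by simp
  finally have "AE \<omega> in M. (\<Sum>n. ennreal \<bar>h n \<omega>\<bar>) \<noteq> \<infinity>"
    by (intro nn_integral_noteq_infinite) auto
  then show ?thesis
  proof eventually_elim
    case (elim \<omega>)
    then have "summable (\<lambda>n. \<bar>h n \<omega>\<bar>)"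
      by (intro summable_suminf_not_top) auto
    then show ?case by (rule summable_rabs_cancel)
  qed
qed

text \<open>
  The norms of the projections decrease along \<open>F\<close>. A decreasing sequence \<open>W n\<close> in \<open>F\<close> whose norms
  approach the infimum \<open>s\<close> fast enough gives projections \<open>d n\<close> that converge almost everywhere. For any
  \<open>v \<in> F\<close>, replacing \<open>W n\<close> by \<open>W n \<inter> v\<close> lowers the squared norm by at most \<open>(1/4)\<^sup>n\<close>, so it leaves
  the limit unchanged: the limit is measurable with respect to every \<open>v \<in> F\<close>, thus trivial, and being
  centred it is \<open>0\<close>. The bound on \<open>a\<close> provides domination, which carries the limit over to norms.
\<close>

lemma sf_cond_exp_filter_small:
  assumes F: "F \<subseteq> sub_sigma_fields M" "F \<noteq> {}" and meet: "\<And>u v. u \<in> F \<Longrightarrow> v \<in> F \<Longrightarrow> u \<inter> v \<in> F"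
    and triv: "\<Inter>F \<subseteq> trivial_sf M"
    and a: "a \<in> borel_measurable M" "AE \<omega> in M. \<bar>a \<omega>\<bar> \<le> c" and zero: "expectation a = 0"
    and "0 < e"
  shows "\<exists>w\<in>F. expectation (\<lambda>\<omega>. (sf_cond_exp M w a \<omega>)\<^sup>2) < e"
proof -
  define N where "N w = expectation (\<lambda>\<omega>. (sf_cond_exp M w a \<omega>)\<^sup>2)" for w
  have aL2: "a \<in> L2_space M" by (rule L2_space_bounded[OF a])
  have aint: "integrable M a" using L2_spaceD[OF aL2] by auto
  define s where "s = Inf (N ` F)"
  have N_nonneg: "0 \<le> N w" for w by (simp add: N_def)
  have bdd: "bdd_below (N ` F)" by (rule bdd_belowI2[of _ 0]) (rule N_nonneg)
  have s_le: "s \<le> N w" if "w \<in> F" for w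
    unfolding s_def using bdd that by (rule cINF_lower)
  have mono: "N u \<le> N v" if "u \<in> F" "v \<in> F" "u \<subseteq> v" for u v
    unfolding N_def using that F aL2 by (intro sf_cond_exp_norm_mono) auto
  have "\<exists>w\<in>F. N w < s + (1/4) ^ n" for n :: nat
    using cINF_less_iff[OF F(2) bdd, of "s + (1/4) ^ n"] unfolding s_def by auto
  then obtain W0 where W0: "\<And>n::nat. W0 n \<in> F" "\<And>n. N (W0 n) < s + (1/4) ^ n"
    by metis
  define W where "W n = (\<Inter>i\<le>n. W0 i)" for n
  have W_F: "W n \<in> F" for n
  proof (induction n)
    case (Suc n)
    have "W (Suc n) = W n \<inter> W0 (Suc n)" by (auto simp: W_def le_Suc_eq)
    with Suc W0 meet show ?case by simp
  qed (simp add: W_def W0)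
  have W_dec: "W (Suc n) \<subseteq> W n" for n by (auto simp: W_def)
  have NW: "N (W n) < s + (1/4) ^ n" for n
    using mono[OF W_F[of n] W0(1)[of n]] W0(2)[of n] by (force simp: W_def)
  have near: "expectation (\<lambda>\<omega>. (sf_cond_exp M (W n) a \<omega> - sf_cond_exp M u a \<omega>)\<^sup>2) \<le> (1/4) ^ n"
    if "u \<in> F" "u \<subseteq> W n" for u n
    using sf_cond_exp_pythagoras_nested[OF _ _ that(2) aL2] F W_F[of n] that(1) s_le[OF that(1)]
      NW[of n] by (fastforce simp: N_def)
  have diffL2: "(\<lambda>\<omega>. sf_cond_exp M u a \<omega> - sf_cond_exp M v a \<omega>) \<in> L2_space M"
    if "u \<in> F" "v \<in> F" for u v
    using that F aL2 by (intro L2_space_diff sf_cond_exp_L2) auto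
  define d where "d n = sf_cond_exp M (W n) a" for n
  define D where "D \<omega> = lim (\<lambda>n. d n \<omega>)" for \<omega>
  have d_meas [measurable]: "d n \<in> borel_measurable M" for n by (simp add: d_def)
  have D_meas [measurable]: "D \<in> borel_measurable M"
    unfolding D_def by (rule borel_measurable_lim_metric) simp
  have "AE \<omega> in M. summable (\<lambda>n. d n \<omega> - d (Suc n) \<omega>)"
    unfolding d_def by (intro AE_summable_of_L2_geometric diffL2 near W_F W_dec)
  then have d_lim: "AE \<omega> in M. (\<lambda>n. d n \<omega>) \<longlonglongrightarrow> D \<omega>"
  proof eventually_elim
    case (elim \<omega>)
    have "(\<lambda>n. \<Sum>i<n. d i \<omega> - d (Suc i) \<omega>) = (\<lambda>n. d 0 \<omega> - d n \<omega>)"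
      by (rule ext) (rule sum_lessThan_telescope')
    with elim have "convergent (\<lambda>n. d 0 \<omega> - d n \<omega>)"
      by (simp add: summable_iff_convergent)
    then obtain L where "(\<lambda>n. d 0 \<omega> - d n \<omega>) \<longlonglongrightarrow> L"
      by (auto simp: convergent_def)
    then have "(\<lambda>n. d 0 \<omega> - (d 0 \<omega> - d n \<omega>)) \<longlonglongrightarrow> d 0 \<omega> - L"
      by (intro tendsto_diff tendsto_const)
    then have "(\<lambda>n. d n \<omega>) \<longlonglongrightarrow> d 0 \<omega> - L" by simp
    then show ?case unfolding D_def using limI by metis
  qed
  have d_bound: "AE \<omega> in M. norm (d n \<omega>) \<le> c" for n
    using sf_cond_exp_abs_le[OF _ aint a(2), of "W n"] F W_F by (auto simp: d_def)
  have D_zero: "AE \<omega> in M. D \<omega> = 0"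
  proof (rule AE_zero_of_trivial)
    show "integrable M D"
      by (rule integrable_dominated_convergence[where w="\<lambda>_. c" and s=d])
        (use d_lim d_bound in auto)
    have "(\<lambda>n. expectation (d n)) \<longlonglongrightarrow> expectation D"
      by (rule integral_dominated_convergence[where w="\<lambda>_. c"]) (use d_lim d_bound in auto)
    moreover have "expectation (d n) = 0" for n
      using sf_cond_exp_int(2)[OF _ aint, of "W n"] F W_F zero by (auto simp: d_def)
    ultimately show "expectation D = 0"
      by (simp add: LIMSEQ_const_iff)
    \<comment> \<open>The \<open>v\<close>-measurable variables \<open>b n\<close> have the same limit as the \<open>d n\<close>.\<close>
    have "{\<omega> \<in> space M. 0 < D \<omega>} \<in> v" if v: "v \<in> F" for v
    proof (rule sub_sigma_field_AE_eq)
      show v': "v \<in> sub_sigma_fields M" using v F by auto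
      show "{\<omega> \<in> space M. 0 < D \<omega>} \<in> sets M" by measurable
      define b where "b n = sf_cond_exp M (W n \<inter> v) a" for n
      have b_F: "W n \<inter> v \<in> F" for n using W_F v meet by auto
      have b_meas: "b n \<in> borel_measurable (sigma (space M) v)" for n
        unfolding b_def using b_F F v'
        by (intro sub_sigma_field_measurable_mono[OF _ v' _ sf_cond_exp_measurable]) auto
      have "(\<lambda>\<omega>. lim (\<lambda>n. b n \<omega>)) \<in> borel_measurable (sigma (space M) v)"
        by (rule borel_measurable_lim_metric[OF b_meas])
      then have "{\<omega> \<in> space (sigma (space M) v). 0 < lim (\<lambda>n. b n \<omega>)} \<in> sets (sigma (space M) v)"
        by measurable
      then show "{\<omega> \<in> space M. 0 < lim (\<lambda>n. b n \<omega>)} \<in> v"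
        using sigma_sub_sigma_field[OF v'] by simp
      have "AE \<omega> in M. summable (\<lambda>n. d n \<omega> - b n \<omega>)"
        unfolding d_def b_def by (intro AE_summable_of_L2_geometric diffL2 near W_F b_F) auto
      with d_lim AE_space
      show "AE \<omega> in M. \<omega> \<in> {\<omega> \<in> space M. 0 < D \<omega>} \<longleftrightarrow> \<omega> \<in> {\<omega> \<in> space M. 0 < lim (\<lambda>n. b n \<omega>)}"
      proof eventually_elim
        case (elim \<omega>)
        have "(\<lambda>n. d n \<omega> - (d n \<omega> - b n \<omega>)) \<longlonglongrightarrow> D \<omega> - 0"
          by (intro tendsto_diff elim(1) summable_LIMSEQ_zero elim(3))
        then have "lim (\<lambda>n. b n \<omega>) = D \<omega>" by (intro limI) simp
        then show ?case by simp
      qed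
    qed
    with triv show "{\<omega> \<in> space M. 0 < D \<omega>} \<in> trivial_sf M" by blast
  qed
  have "(\<lambda>n. expectation (\<lambda>\<omega>. (d n \<omega>)\<^sup>2)) \<longlonglongrightarrow> expectation (\<lambda>\<omega>. 0)"
  proof (rule integral_dominated_convergence[where w="\<lambda>_. c\<^sup>2"])
    show "AE \<omega> in M. (\<lambda>n. (d n \<omega>)\<^sup>2) \<longlonglongrightarrow> 0"
      using d_lim D_zero by eventually_elim (auto intro: tendsto_eq_intros)
    show "AE \<omega> in M. norm ((d n \<omega>)\<^sup>2) \<le> c\<^sup>2" for n
      using d_bound[of n]
    proof eventually_elim
      case (elim \<omega>)
      then have "\<bar>d n \<omega>\<bar>\<^sup>2 \<le> c\<^sup>2" by (intro power_mono) auto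
      then show ?case by simp
    qed
  qed auto
  then have "\<forall>\<^sub>F n in sequentially. N (W n) < e"
    using \<open>0 < e\<close> by (auto simp: N_def d_def dest: order_tendstoD(2))
  then obtain n where "N (W n) < e" by (auto dest: eventually_happens)
  with W_F show ?thesis by (auto simp: N_def)
qed

end

section \<open>Noise-type Boolean algebras\<close>

context noise_type_boolean_algebra
begin

lemma mem_sub_sigma_field: "x \<in> B \<Longrightarrow> x \<in> sub_sigma_fields M"
  using sub_sigma_fields by auto

lemma mem_subset_sets: "x \<in> B \<Longrightarrow> x \<subseteq> sets M"
  using mem_sub_sigma_field by (auto simp: sub_sigma_fields_def)

lemma join_sub_sigma_field: "x \<in> B \<Longrightarrow> y \<in> B \<Longrightarrow> sf_join M x y \<in> sub_sigma_fields M"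
  using join_closed mem_sub_sigma_field by auto

lemma join_least:
  assumes "z \<in> B" "x \<subseteq> z" "y \<subseteq> z"
  shows "sf_join M x y \<subseteq> z"
proof -
  interpret z: sigma_algebra "space M" z
    using mem_sub_sigma_field[OF assms(1)] by (auto simp: sub_sigma_fields_def)
  show ?thesis
    unfolding sf_join_def using assms by (intro z.sigma_sets_subset) auto
qed

lemma meet_complement_join:
  assumes "w \<in> B" "u \<in> B"
  shows "sf_join M (w \<inter> u) (w \<inter> sf_complement M B u) = w"
proof -
  have "sf_join M (w \<inter> u) (w \<inter> sf_complement M B u) = w \<inter> sf_join M u (sf_complement M B u)"
    using meet_join_distrib[OF assms sf_complement(1)[OF assms(2)]] by simp
  also have "\<dots> = w"
    using sf_complement(2)[OF assms(2)] mem_subset_sets[OF assms(1)]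
    by (auto simp: is_sf_complement_def)
  finally show ?thesis .
qed

lemma meet_complement_indep:
  assumes "u \<in> B"
  shows "indep_set (w \<inter> u) (w \<inter> sf_complement M B u)"
  using indep_sf_mono[OF complement_indep[OF assms]] by auto

lemma sf_complement_unique:
  assumes "x \<in> B" "y \<in> B" "is_sf_complement M x y"
  shows "sf_complement M B x = y"
  using complement_ex1[OF assms(1)] sf_complement[OF assms(1)] assms(2,3) by blast

lemma sf_complement_trivial: "sf_complement M B (trivial_sf M) = sets M"
proof (rule sf_complement_unique[OF trivial_mem full_mem])
  have "sigma_sets (space M) (sets M) = sets M"
    by (rule sets.sigma_sets_eq)
  moreover have "trivial_sf M \<subseteq> sets M" by (rule trivial_subset[OF full_mem])
  ultimately show "is_sf_complement M (trivial_sf M) (sets M)"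
    by (auto simp: is_sf_complement_def sf_join_def Un_absorb1)
qed

text \<open>
  The Boolean prime ideal theorem, by Zorn's lemma for the filters that avoid \<open>J\<close>. A maximal such
  filter that omitted both \<open>x\<close> and its complement could be enlarged by neither, so some meets
  \<open>y \<inter> x\<close> and \<open>y' \<inter> x'\<close> with \<open>y\<close>, \<open>y'\<close> in the filter would lie in \<open>J\<close>; their join contains
  \<open>y \<inter> y'\<close>, which would then lie in \<open>J\<close> as well.
\<close>

lemma ultrafilter_avoiding_ideal:
  assumes J: "J \<subseteq> B" "trivial_sf M \<in> J" "sets M \<notin> J"
    and down: "\<And>u v. u \<in> J \<Longrightarrow> v \<in> B \<Longrightarrow> v \<subseteq> u \<Longrightarrow> v \<in> J"
    and join: "\<And>u v. u \<in> J \<Longrightarrow> v \<in> J \<Longrightarrow> sf_join M u v \<in> J"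
  shows "\<exists>F. ultrafilter_in M B F \<and> F \<inter> J = {}"
proof -
  define \<A> where "\<A> = {G. G \<subseteq> B \<and> sets M \<in> G \<and> (\<forall>x\<in>G. \<forall>y\<in>B. x \<subseteq> y \<longrightarrow> y \<in> G) \<and>
    (\<forall>x\<in>G. \<forall>y\<in>G. x \<inter> y \<in> G) \<and> G \<inter> J = {}}"
  have \<A>_D: "G \<subseteq> B" "sets M \<in> G" "G \<inter> J = {}"
      "\<And>u v. u \<in> G \<Longrightarrow> v \<in> B \<Longrightarrow> u \<subseteq> v \<Longrightarrow> v \<in> G"
      "\<And>u v. u \<in> G \<Longrightarrow> v \<in> G \<Longrightarrow> u \<inter> v \<in> G" if "G \<in> \<A>" for G
    using that by (simp_all add: \<A>_def)
  have \<A>_I: "G \<in> \<A>" if "G \<subseteq> B" "sets M \<in> G" "G \<inter> J = {}"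
      "\<And>u v. u \<in> G \<Longrightarrow> v \<in> B \<Longrightarrow> u \<subseteq> v \<Longrightarrow> v \<in> G"
      "\<And>u v. u \<in> G \<Longrightarrow> v \<in> G \<Longrightarrow> u \<inter> v \<in> G" for G
    using that by (simp add: \<A>_def)
  have "{sets M} \<in> \<A>"
    using full_mem J(3) mem_subset_sets by (auto simp: \<A>_def)
  then have "\<A> \<noteq> {}" by auto
  moreover have "\<Union>C \<in> \<A>" if ne: "C \<noteq> {}" and chain: "subset.chain \<A> C" for C
  proof -
    have C: "C \<subseteq> \<A>" and lin: "\<And>X Y. X \<in> C \<Longrightarrow> Y \<in> C \<Longrightarrow> X \<subseteq> Y \<or> Y \<subseteq> X"
      using chain by (auto simp: subset_chain_def)
    obtain X0 where X0: "X0 \<in> C" using ne by blast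
    show ?thesis
    proof (rule \<A>_I)
      show "\<Union>C \<subseteq> B" using C \<A>_D(1) by blast
      show "sets M \<in> \<Union>C" using C X0 \<A>_D(2) by blast
      show "\<Union>C \<inter> J = {}" using C \<A>_D(3) by blast
    next
      fix u v assume "u \<in> \<Union>C" "v \<in> B" "u \<subseteq> v"
      then obtain X where X: "X \<in> C" "u \<in> X" by blast
      then have "v \<in> X" using C \<A>_D(4)[of X u v] \<open>v \<in> B\<close> \<open>u \<subseteq> v\<close> by blast
      with X show "v \<in> \<Union>C" by blast
    next
      fix u v assume "u \<in> \<Union>C" "v \<in> \<Union>C"
      then obtain X Y where "X \<in> C" "u \<in> X" "Y \<in> C" "v \<in> Y" by auto
      then obtain Z where Z: "Z \<in> C" "u \<in> Z" "v \<in> Z" using lin[of X Y] by blast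
      then have "u \<inter> v \<in> Z" using C \<A>_D(5)[of Z u v] by blast
      with Z show "u \<inter> v \<in> \<Union>C" by blast
    qed
  qed
  ultimately obtain F where F: "F \<in> \<A>" and max: "\<And>G. G \<in> \<A> \<Longrightarrow> F \<subseteq> G \<Longrightarrow> G = F"
    using subset_Zorn_nonempty[of \<A>] by blast
  note FB = \<A>_D(1)[OF F] and top = \<A>_D(2)[OF F] and FJ = \<A>_D(3)[OF F]
    and up = \<A>_D(4)[OF F] and meet = \<A>_D(5)[OF F]
  have hits: "\<exists>y\<in>F. y \<inter> x \<in> J" if x: "x \<in> B" "x \<notin> F" for x
  proof (rule ccontr)
    assume no: "\<not> (\<exists>y\<in>F. y \<inter> x \<in> J)"
    define G where "G = {z \<in> B. \<exists>y\<in>F. y \<inter> x \<subseteq> z}"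
    have "sets M \<in> G" using full_mem top mem_subset_sets[OF x(1)] by (auto simp: G_def)
    moreover have "u \<inter> v \<in> G" if uv: "u \<in> G" "v \<in> G" for u v
    proof -
      obtain y y' where "y \<in> F" "y \<inter> x \<subseteq> u" "y' \<in> F" "y' \<inter> x \<subseteq> v"
        using uv by (auto simp: G_def)
      then have "y \<inter> y' \<in> F" "(y \<inter> y') \<inter> x \<subseteq> u \<inter> v" using meet by auto
      then show ?thesis using uv meet_closed by (auto simp: G_def)
    qed
    moreover have "G \<inter> J = {}"
    proof (rule ccontr)
      assume "G \<inter> J \<noteq> {}"
      then obtain z y where "z \<in> J" "y \<in> F" "y \<inter> x \<subseteq> z" by (auto simp: G_def)
      moreover from this have "y \<inter> x \<in> B" using FB x meet_closed by auto
      ultimately show False using no down by blast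
    qed
    moreover have "v \<in> G" if "u \<in> G" "v \<in> B" "u \<subseteq> v" for u v
      using that by (auto simp: G_def)
    moreover have "G \<subseteq> B" by (auto simp: G_def)
    ultimately have "G \<in> \<A>" by (intro \<A>_I)
    moreover have "F \<subseteq> G" using FB by (auto simp: G_def)
    moreover have "x \<in> G" using x top by (auto simp: G_def)
    ultimately show False using max x by blast
  qed
  have "sf_complement M B x \<in> F" if x: "x \<in> B" "x \<notin> F" for x
  proof (rule ccontr)
    assume nx: "sf_complement M B x \<notin> F"
    let ?x' = "sf_complement M B x"
    have x': "?x' \<in> B" by (rule sf_complement(1)[OF x(1)])
    obtain y y' where y: "y \<in> F" "y \<inter> x \<in> J" "y' \<in> F" "y' \<inter> ?x' \<in> J"
      using hits[OF x] hits[OF x' nx] by auto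
    let ?w = "y \<inter> y'"
    have w: "?w \<in> F" "?w \<in> B" using meet y FB by auto
    have "?w \<inter> x \<in> J" "?w \<inter> ?x' \<in> J"
      using y w x x' meet_closed
      by (auto intro: down[of "y \<inter> x"] down[of "y' \<inter> ?x'"])
    then have "sf_join M (?w \<inter> x) (?w \<inter> ?x') \<in> J" by (rule join)
    with w FJ show False using meet_complement_join[OF w(2) x(1)] by auto
  qed
  then have "ultrafilter_in M B F"
    using FB up meet FJ J(2) unfolding ultrafilter_in_def by blast
  with FJ show ?thesis by blast
qed

text \<open>
  Independence of \<open>x\<close> and its complement \<open>x'\<close> turns the pairing of either side with \<open>1\<^sub>A 1\<^sub>C\<close>, for
  \<open>A \<in> w \<inter> x\<close> and \<open>C \<in> w \<inter> x'\<close>, into the same product of two expectations, and by distributivity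
  such events generate \<open>w\<close>.
\<close>

lemma sf_cond_exp_product:
  fixes a c :: "'a \<Rightarrow> real"
  assumes w: "w \<in> B" and x: "x \<in> B"
    and a: "integrable M a" "a \<in> borel_measurable (sigma (space M) x)"
    and c: "integrable M c" "c \<in> borel_measurable (sigma (space M) (sf_complement M B x))"
  shows "AE \<omega> in M. sf_cond_exp M w (\<lambda>\<omega>. a \<omega> * c \<omega>) \<omega>
    = sf_cond_exp M (w \<inter> x) a \<omega> * sf_cond_exp M (w \<inter> sf_complement M B x) c \<omega>"
proof -
  let ?x' = "sf_complement M B x"
  let ?p = "w \<inter> x" and ?q = "w \<inter> ?x'"
  have x': "?x' \<in> B" by (rule sf_complement(1)[OF x])
  have pq: "?p \<in> B" "?q \<in> B" using w x x' meet_closed by auto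
  note sp = mem_sub_sigma_field[OF pq(1)] and sq = mem_sub_sigma_field[OF pq(2)]
    and sx = mem_sub_sigma_field[OF x] and sx' = mem_sub_sigma_field[OF x']
    and sw = mem_sub_sigma_field[OF w]
  have join: "sf_join M ?p ?q = w" by (rule meet_complement_join[OF w x])
  have ind: "indep_set ?p ?q" by (rule meet_complement_indep[OF x])
  have eq: "expectation (\<lambda>\<omega>. sf_cond_exp M v h \<omega> * indicator A \<omega>) = expectation (\<lambda>\<omega>. h \<omega> * indicator A \<omega>)"
    if "v \<in> sub_sigma_fields M" "integrable M h" "A \<in> v" for v A and h :: "'a \<Rightarrow> real"
    using sf_cond_exp_mult(2)[OF that(1) indicator_sub_sigma_field(1)[OF that(1,3)], of h] that(2)
      integrable_real_mult_indicator[OF indicator_sub_sigma_field(2)[OF that(1,3)] that(2)]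
    by (simp add: mult.commute)
  have "AE \<omega> in M. sf_cond_exp M (sf_join M ?p ?q) (\<lambda>\<omega>. a \<omega> * c \<omega>) \<omega>
      = sf_cond_exp M ?p a \<omega> * sf_cond_exp M ?q c \<omega>"
  proof (rule sf_cond_exp_joinI[OF sp sq])
    show "sf_join M ?p ?q \<in> sub_sigma_fields M" using join sw by simp
    show "integrable M (\<lambda>\<omega>. a \<omega> * c \<omega>)"
      by (rule indep_sf_expectation(1)[OF sx sx' complement_indep[OF x] a c])
    show "integrable M (\<lambda>\<omega>. sf_cond_exp M ?p a \<omega> * sf_cond_exp M ?q c \<omega>)"
      by (rule indep_sf_expectation(1)[OF sp sq ind sf_cond_exp_int(1)[OF sp a(1)]
            sf_cond_exp_measurable sf_cond_exp_int(1)[OF sq c(1)] sf_cond_exp_measurable])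
    show "(\<lambda>\<omega>. sf_cond_exp M ?p a \<omega> * sf_cond_exp M ?q c \<omega>)
        \<in> borel_measurable (sigma (space M) (sf_join M ?p ?q))"
      unfolding join
      by (intro borel_measurable_times sub_sigma_field_measurable_mono[OF sp sw]
          sub_sigma_field_measurable_mono[OF sq sw] sf_cond_exp_measurable) auto
    fix A C assume A: "A \<in> ?p" and C: "C \<in> ?q"
    then have "A \<in> x" "C \<in> ?x'" by auto
    then have "expectation (\<lambda>\<omega>. a \<omega> * c \<omega> * (indicator A \<omega> * indicator C \<omega>))
        = expectation (\<lambda>\<omega>. a \<omega> * indicator A \<omega>) * expectation (\<lambda>\<omega>. c \<omega> * indicator C \<omega>)"
      by (rule indep_sf_expectation_indicators(2)[OF sx sx' complement_indep[OF x] a c])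
    also have "\<dots> = expectation (\<lambda>\<omega>. sf_cond_exp M ?p a \<omega> * sf_cond_exp M ?q c \<omega>
        * (indicator A \<omega> * indicator C \<omega>))"
      using indep_sf_expectation_indicators(2)[OF sp sq ind sf_cond_exp_int(1)[OF sp a(1)]
            sf_cond_exp_measurable sf_cond_exp_int(1)[OF sq c(1)] sf_cond_exp_measurable A C]
        eq[OF sp a(1) A] eq[OF sq c(1) C] by simp
    finally show "expectation (\<lambda>\<omega>. a \<omega> * c \<omega> * (indicator A \<omega> * indicator C \<omega>))
      = expectation (\<lambda>\<omega>. sf_cond_exp M ?p a \<omega> * sf_cond_exp M ?q c \<omega>
        * (indicator A \<omega> * indicator C \<omega>))" .
  qed
  then show ?thesis unfolding join .
qed

section \<open>The first chaos\<close>

lemma first_chaosD: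
  assumes "f \<in> first_chaos M B"
  shows "f \<in> L2_space M"
    "x \<in> B \<Longrightarrow>
      AE \<omega> in M. f \<omega> = sf_cond_exp M x f \<omega> + sf_cond_exp M (sf_complement M B x) f \<omega>"
  using assms by (auto simp: first_chaos_def)

text \<open>
  The defining identity for the trivial sigma-field, whose complement is the full one, reads
  \<open>f = E f + f\<close>.
\<close>

lemma first_chaos_trivial:
  assumes f: "f \<in> first_chaos M B"
  shows "AE \<omega> in M. sf_cond_exp M (trivial_sf M) f \<omega> = 0" "expectation f = 0"
proof -
  note fL2 = first_chaosD(1)[OF f]
  have full: "AE \<omega> in M. sf_cond_exp M (sets M) f \<omega> = f \<omega>"
    using L2_spaceD[OF fL2] mem_sub_sigma_field[OF full_mem]
    by (intro sf_cond_exp_measurable_eq) (auto simp: measurable_def)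
  have "AE \<omega> in M. f \<omega> = sf_cond_exp M (trivial_sf M) f \<omega> + sf_cond_exp M (sets M) f \<omega>"
    using first_chaosD(2)[OF f trivial_mem] by (simp add: sf_complement_trivial)
  with full show zero: "AE \<omega> in M. sf_cond_exp M (trivial_sf M) f \<omega> = 0"
    by eventually_elim simp
  have "expectation f = expectation (sf_cond_exp M (trivial_sf M) f)"
    using sf_cond_exp_int(2)[OF mem_sub_sigma_field[OF trivial_mem]] L2_spaceD[OF fL2] by simp
  also have "\<dots> = expectation (\<lambda>\<omega>. 0)"
    using zero by (intro integral_cong_AE) auto
  finally show "expectation f = 0" by simp
qed

text \<open>
  Decompose \<open>f\<close> along \<open>u\<close>: paired with \<open>1\<^sub>A 1\<^sub>C\<close> for \<open>A \<in> u\<close> and \<open>C\<close> in the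
  complement of \<open>u\<close>, each of its two terms splits off one factor by independence.
\<close>

lemma first_chaos_additive:
  assumes f: "f \<in> first_chaos M B" and w: "w \<in> B" and u: "u \<in> B"
  shows "AE \<omega> in M. sf_cond_exp M w f \<omega>
    = sf_cond_exp M (w \<inter> u) f \<omega> + sf_cond_exp M (w \<inter> sf_complement M B u) f \<omega>"
proof -
  let ?u' = "sf_complement M B u"
  let ?p = "w \<inter> u" and ?q = "w \<inter> ?u'"
  have u': "?u' \<in> B" by (rule sf_complement(1)[OF u])
  have pq: "?p \<in> B" "?q \<in> B" using w u u' meet_closed by auto
  note su = mem_sub_sigma_field[OF u] and su' = mem_sub_sigma_field[OF u']
  note ind = complement_indep[OF u]
  have fint: "integrable M f" using L2_spaceD[OF first_chaosD(1)[OF f]] by auto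
  have "AE \<omega> in M. sf_cond_exp M (sf_join M ?p ?q) f \<omega>
      = sf_cond_exp M ?p f \<omega> + sf_cond_exp M ?q f \<omega>"
  proof (rule sf_cond_exp_add_joinI)
    show "?p \<in> sub_sigma_fields M" "?q \<in> sub_sigma_fields M" "sf_join M ?p ?q \<in> sub_sigma_fields M"
      using mem_sub_sigma_field pq join_sub_sigma_field by auto
    show "indep_set ?p ?q" by (rule meet_complement_indep[OF u])
    show "integrable M f" by (rule fint)
    fix A C assume "A \<in> ?p" "C \<in> ?q"
    then have A: "A \<in> u" and C: "C \<in> ?u'" by auto
    have AC: "A \<in> sets M" "C \<in> sets M" using A C mem_subset_sets u u' by auto
    have "expectation (\<lambda>\<omega>. f \<omega> * (indicator A \<omega> * indicator C \<omega>))
      = expectation (\<lambda>\<omega>. sf_cond_exp M u f \<omega> * (indicator A \<omega> * indicator C \<omega>)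
          + sf_cond_exp M ?u' f \<omega> * (indicator C \<omega> * indicator A \<omega>))"
      using first_chaosD(2)[OF f u] AC fint
      by (intro integral_cong_AE) (auto elim!: eventually_mono simp: algebra_simps)
    also have "\<dots> = expectation (\<lambda>\<omega>. f \<omega> * indicator A \<omega>) * prob C
          + expectation (\<lambda>\<omega>. f \<omega> * indicator C \<omega>) * prob A"
      using sf_cond_exp_indicators[OF su su' ind fint A C]
        sf_cond_exp_indicators[OF su' su indep_sf_sym[OF ind] fint C A] by simp
    finally show "expectation (\<lambda>\<omega>. f \<omega> * (indicator A \<omega> * indicator C \<omega>))
      = expectation (\<lambda>\<omega>. f \<omega> * indicator A \<omega>) * prob C
          + expectation (\<lambda>\<omega>. f \<omega> * indicator C \<omega>) * prob A" .
  qed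
  then show ?thesis by (simp add: meet_complement_join[OF w u])
qed

section \<open>Products of centred variables are orthogonal to the first chaos\<close>

text \<open>
  Projecting \<open>a c\<close> to \<open>w\<close> gives a product of independent factors, whose squared norm is at most
  \<open>e\<^sup>2\<close> times that of the projection of \<open>c\<close>. The bound has the form of a sum of squared norms because
  Bessel's inequality makes such a sum superadditive over disjoint elements, so that the estimate
  passes from pieces to their join with the same \<open>e\<close>.
\<close>

lemma product_pairing_le:
  fixes a c :: "'a \<Rightarrow> real"
  assumes w: "w \<in> B" and x: "x \<in> B" and f: "f \<in> L2_space M" and e: "0 < e"
    and a: "a \<in> borel_measurable (sigma (space M) x)" "\<And>\<omega>. \<bar>a \<omega>\<bar> \<le> 1"
    and c: "c \<in> borel_measurable (sigma (space M) (sf_complement M B x))" "\<And>\<omega>. \<bar>c \<omega>\<bar> \<le> 1"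
    and small: "expectation (\<lambda>\<omega>. (sf_cond_exp M (w \<inter> x) a \<omega>)\<^sup>2) \<le> e\<^sup>2"
  shows "\<bar>expectation (\<lambda>\<omega>. sf_cond_exp M w f \<omega> * (a \<omega> * c \<omega>))\<bar>
    \<le> e * (expectation (\<lambda>\<omega>. (sf_cond_exp M w f \<omega>)\<^sup>2)
      + expectation (\<lambda>\<omega>. (sf_cond_exp M (w \<inter> sf_complement M B x) c \<omega>)\<^sup>2))"
proof -
  let ?x' = "sf_complement M B x"
  have x': "?x' \<in> B" by (rule sf_complement(1)[OF x])
  have pq: "w \<inter> x \<in> B" "w \<inter> ?x' \<in> B" using w x x' meet_closed by auto
  note sw = mem_sub_sigma_field[OF w] and sp = mem_sub_sigma_field[OF pq(1)]
    and sq = mem_sub_sigma_field[OF pq(2)]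
  define fw where "fw = sf_cond_exp M w f"
  define aw where "aw = sf_cond_exp M (w \<inter> x) a"
  define cw where "cw = sf_cond_exp M (w \<inter> ?x') c"
  have aM: "a \<in> borel_measurable M" and cM: "c \<in> borel_measurable M"
    using sub_sigma_field_measurable mem_sub_sigma_field x x' a c by blast+
  have aL2: "a \<in> L2_space M" and cL2: "c \<in> L2_space M"
    using aM cM a(2) c(2) by (auto intro!: L2_space_bounded[of _ 1])
  have fwL2: "fw \<in> L2_space M" and awL2: "aw \<in> L2_space M" and cwL2: "cw \<in> L2_space M"
    unfolding fw_def aw_def cw_def using sf_cond_exp_L2 sw sp sq f aL2 cL2 by auto
  have ac_le: "\<bar>a \<omega> * c \<omega>\<bar> \<le> 1" for \<omega>
    using mult_mono[OF a(2) c(2), of \<omega> \<omega>] by (simp add: abs_mult)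
  have acL2: "(\<lambda>\<omega>. a \<omega> * c \<omega>) \<in> L2_space M"
    using aM cM ac_le by (intro L2_space_bounded[of _ 1]) auto
  have prod: "AE \<omega> in M. sf_cond_exp M w (\<lambda>\<omega>. a \<omega> * c \<omega>) \<omega> = aw \<omega> * cw \<omega>"
    unfolding aw_def cw_def
    using sf_cond_exp_product[OF w x _ a(1) _ c(1)] L2_spaceD[OF aL2] L2_spaceD[OF cL2] by blast
  note ind = meet_complement_indep[OF x, of w]
  have sqmeas: "(\<lambda>\<omega>. (aw \<omega>)\<^sup>2) \<in> borel_measurable (sigma (space M) (w \<inter> x))"
    "(\<lambda>\<omega>. (cw \<omega>)\<^sup>2) \<in> borel_measurable (sigma (space M) (w \<inter> ?x'))"
    unfolding aw_def cw_def by measurable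
  note sqprod = indep_sf_expectation[OF sp sq ind L2_spaceD(2)[OF awL2] sqmeas(1)
      L2_spaceD(2)[OF cwL2] sqmeas(2)]
  have [measurable]: "fw \<in> borel_measurable M" "aw \<in> borel_measurable M" "cw \<in> borel_measurable M"
    using L2_spaceD fwL2 awL2 cwL2 by auto
  \<comment> \<open>The weights \<open>e\<close> and \<open>1/e\<close> balance: the factor \<open>q\<close> will have squared norm of order \<open>e\<^sup>2\<close>.\<close>
  have young: "\<bar>p * q\<bar> \<le> e * p\<^sup>2 + q\<^sup>2 / e" for p q :: real
  proof -
    have "0 \<le> (e * \<bar>p\<bar> - \<bar>q\<bar>)\<^sup>2 / e" using e by simp
    also have "\<dots> = e * p\<^sup>2 + q\<^sup>2 / e - 2 * \<bar>p * q\<bar>"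
      using e by (simp add: power2_diff abs_mult field_simps power2_eq_square)
    finally show ?thesis by linarith
  qed
  have "expectation (\<lambda>\<omega>. fw \<omega> * (a \<omega> * c \<omega>))
      = expectation (\<lambda>\<omega>. fw \<omega> * sf_cond_exp M w (\<lambda>\<omega>. a \<omega> * c \<omega>) \<omega>)"
    unfolding fw_def
    by (rule sf_cond_exp_orthogonal[OF sw acL2 sf_cond_exp_L2[OF sw f]
          sf_cond_exp_measurable, symmetric])
  also have "\<dots> = expectation (\<lambda>\<omega>. fw \<omega> * (aw \<omega> * cw \<omega>))"
    using prod by (intro integral_cong_AE) (auto elim: eventually_mono)
  finally have "\<bar>expectation (\<lambda>\<omega>. fw \<omega> * (a \<omega> * c \<omega>))\<bar>
      \<le> expectation (\<lambda>\<omega>. \<bar>fw \<omega> * (aw \<omega> * cw \<omega>)\<bar>)"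
    by simp
  also have "\<dots> \<le> expectation (\<lambda>\<omega>. e * (fw \<omega>)\<^sup>2 + (aw \<omega>)\<^sup>2 * (cw \<omega>)\<^sup>2 / e)"
  proof (rule integral_mono')
    show "integrable M (\<lambda>\<omega>. e * (fw \<omega>)\<^sup>2 + (aw \<omega>)\<^sup>2 * (cw \<omega>)\<^sup>2 / e)"
      using L2_spaceD(2)[OF fwL2] sqprod(1) by auto
    show "\<bar>fw \<omega> * (aw \<omega> * cw \<omega>)\<bar> \<le> e * (fw \<omega>)\<^sup>2 + (aw \<omega>)\<^sup>2 * (cw \<omega>)\<^sup>2 / e" for \<omega>
      using young[of "fw \<omega>" "aw \<omega> * cw \<omega>"] by (simp add: power_mult_distrib)
    show "0 \<le> e * (fw \<omega>)\<^sup>2 + (aw \<omega>)\<^sup>2 * (cw \<omega>)\<^sup>2 / e" for \<omega>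
      using e by simp
  qed
  also have "\<dots> = e * expectation (\<lambda>\<omega>. (fw \<omega>)\<^sup>2)
      + expectation (\<lambda>\<omega>. (aw \<omega>)\<^sup>2) * expectation (\<lambda>\<omega>. (cw \<omega>)\<^sup>2) / e"
    using L2_spaceD(2)[OF fwL2] sqprod by simp
  also have "\<dots> \<le> e * expectation (\<lambda>\<omega>. (fw \<omega>)\<^sup>2) + e\<^sup>2 * expectation (\<lambda>\<omega>. (cw \<omega>)\<^sup>2) / e"
    using small e by (intro add_left_mono divide_right_mono mult_right_mono) (auto simp: aw_def)
  also have "\<dots> = e * (expectation (\<lambda>\<omega>. (fw \<omega>)\<^sup>2) + expectation (\<lambda>\<omega>. (cw \<omega>)\<^sup>2))"
    using e by (simp add: power2_eq_square distrib_left)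
  finally show ?thesis unfolding fw_def cw_def .
qed

text \<open>
  For fixed \<open>e\<close>, the elements of \<open>B\<^sub>0\<close> below which the estimate of \<open>product_pairing_le\<close> holds form an ideal. It
  has a member in every ultrafilter, because far enough along the ultrafilter the projection of \<open>a\<close> is
  small. Hence the ideal contains the unit, and \<open>e\<close> may tend to \<open>0\<close>.
\<close>

lemma atomless_first_chaos_orthogonal:
  fixes a c :: "'a \<Rightarrow> real"
  assumes B0: "noise_type_boolean_algebra M B\<^sub>0" "B\<^sub>0 \<subseteq> B" and atomless: "atomless_sf_algebra M B\<^sub>0"
    and f: "f \<in> first_chaos M B\<^sub>0" and x: "x \<in> B"
    and a: "a \<in> borel_measurable (sigma (space M) x)" "\<And>\<omega>. \<bar>a \<omega>\<bar> \<le> 1" "expectation a = 0"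
    and c: "c \<in> borel_measurable (sigma (space M) (sf_complement M B x))" "\<And>\<omega>. \<bar>c \<omega>\<bar> \<le> 1"
      "expectation c = 0"
  shows "expectation (\<lambda>\<omega>. f \<omega> * (a \<omega> * c \<omega>)) = 0"
proof -
  interpret B0: noise_type_boolean_algebra M B\<^sub>0 by (rule B0(1))
  let ?x' = "sf_complement M B x"
  have x': "?x' \<in> B" by (rule sf_complement(1)[OF x])
  note fL2 = B0.first_chaosD(1)[OF f]
  have [measurable]: "f \<in> borel_measurable M" "a \<in> borel_measurable M" "c \<in> borel_measurable M"
    using sub_sigma_field_measurable mem_sub_sigma_field x x' a c L2_spaceD(1)[OF fL2] by blast+
  have aL2: "a \<in> L2_space M" and cL2: "c \<in> L2_space M"
    using a(2) c(2) by (auto intro!: L2_space_bounded[of _ 1])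
  have ac_le: "\<bar>a \<omega> * c \<omega>\<bar> \<le> 1" for \<omega>
    using mult_mono[OF a(2) c(2), of \<omega> \<omega>] by (simp add: abs_mult)
  have acL2: "(\<lambda>\<omega>. a \<omega> * c \<omega>) \<in> L2_space M"
    using ac_le by (intro L2_space_bounded[of _ 1]) auto
  define I where "I w = expectation (\<lambda>\<omega>. sf_cond_exp M w f \<omega> * (a \<omega> * c \<omega>))" for w
  define N where "N w h = expectation (\<lambda>\<omega>. (sf_cond_exp M w h \<omega>)\<^sup>2)" for w and h :: "'a \<Rightarrow> real"
  have bound: "\<bar>I (sets M)\<bar> \<le> e * (N (sets M) f + N (sets M \<inter> ?x') c)" if e: "0 < e" for e
  proof -
    define P where "P w \<longleftrightarrow> \<bar>I w\<bar> \<le> e * (N w f + N (w \<inter> ?x') c)" for w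
    define J where "J = {u \<in> B\<^sub>0. \<forall>w\<in>B\<^sub>0. w \<subseteq> u \<longrightarrow> P w}"
    \<comment> \<open>The estimate passes from two complementary pieces of \<open>w\<close> to \<open>w\<close>.\<close>
    have split: "P w" if w: "w \<in> B\<^sub>0" and u: "u \<in> B\<^sub>0"
      and P: "P (w \<inter> u)" "P (w \<inter> sf_complement M B\<^sub>0 u)" for w u
    proof -
      let ?p = "w \<inter> u" and ?q = "w \<inter> sf_complement M B\<^sub>0 u"
      have pq: "?p \<in> B\<^sub>0" "?q \<in> B\<^sub>0"
        using w u B0.sf_complement(1) B0.meet_closed by auto
      have ind: "indep_set ?p ?q" by (rule B0.meet_complement_indep[OF u])
      have s: "v \<inter> ?x' \<in> sub_sigma_fields M" if "v \<in> B\<^sub>0" for v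
        using that B0(2) x' meet_closed mem_sub_sigma_field by blast
      have "I w = expectation (\<lambda>\<omega>. sf_cond_exp M ?p f \<omega> * (a \<omega> * c \<omega>)
          + sf_cond_exp M ?q f \<omega> * (a \<omega> * c \<omega>))"
        unfolding I_def using B0.first_chaos_additive[OF f w u]
        by (intro integral_cong_AE) (auto elim!: eventually_mono simp: distrib_right)
      also have "\<dots> = I ?p + I ?q"
        unfolding I_def using pq B0.mem_sub_sigma_field fL2 acL2
        by (intro Bochner_Integration.integral_add L2_mult_integrable sf_cond_exp_L2) auto
      finally have "\<bar>I w\<bar> \<le> \<bar>I ?p\<bar> + \<bar>I ?q\<bar>" by simp
      also have "\<dots> \<le> e * ((N ?p f + N ?q f) + (N (?p \<inter> ?x') c + N (?q \<inter> ?x') c))"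
        using P by (simp add: P_def distrib_left)
      also have "\<dots> \<le> e * (N w f + N (w \<inter> ?x') c)"
      proof (intro mult_left_mono add_mono)
        show "N ?p f + N ?q f \<le> N w f"
          unfolding N_def using pq w B0.mem_sub_sigma_field fL2 B0.first_chaos_trivial(2)[OF f] ind
          by (intro sf_cond_exp_bessel) auto
        show "N (?p \<inter> ?x') c + N (?q \<inter> ?x') c \<le> N (w \<inter> ?x') c"
          unfolding N_def using s[OF pq(1)] s[OF pq(2)] s[OF w] cL2 c(3)
          by (intro sf_cond_exp_bessel indep_sf_mono[OF ind]) auto
      qed (use e in simp)
      finally show "P w" by (simp add: P_def)
    qed
    have join: "sf_join M u v \<in> J" if u: "u \<in> J" and v: "v \<in> J" for u v
    proof -
      have uv: "u \<in> B\<^sub>0" "v \<in> B\<^sub>0" using u v by (auto simp: J_def)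
      let ?u' = "sf_complement M B\<^sub>0 u"
      have u': "?u' \<in> B\<^sub>0" "u \<inter> ?u' = trivial_sf M"
        using B0.sf_complement[OF uv(1)] by (auto simp: is_sf_complement_def)
      have "P w" if w: "w \<in> B\<^sub>0" "w \<subseteq> sf_join M u v" for w
      proof (rule split[OF w(1) uv(1)])
        show "P (w \<inter> u)"
          using u w uv B0.meet_closed by (auto simp: J_def)
        have "w \<inter> ?u' \<subseteq> ?u' \<inter> sf_join M u v" using w(2) by auto
        also have "\<dots> = sf_join M (?u' \<inter> u) (?u' \<inter> v)"
          by (rule B0.meet_join_distrib[OF u'(1) uv])
        also have "\<dots> \<subseteq> v"
          using u'(2) B0.trivial_subset[OF uv(2)]
          by (intro B0.join_least uv) (auto simp: Int_commute)
        finally show "P (w \<inter> ?u')"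
          using v w u' B0.meet_closed by (auto simp: J_def)
      qed
      then show ?thesis using uv B0.join_closed by (auto simp: J_def)
    qed
    have "sets M \<in> J"
    proof (rule ccontr)
      assume "sets M \<notin> J"
      have "P w" if "w \<in> B\<^sub>0" "w \<subseteq> trivial_sf M" for w
      proof -
        have "w = trivial_sf M" using that B0.trivial_subset by auto
        moreover have "I (trivial_sf M) = expectation (\<lambda>\<omega>. 0)"
          unfolding I_def using B0.first_chaos_trivial(1)[OF f]
          by (intro integral_cong_AE) (auto elim: eventually_mono)
        ultimately show ?thesis using e by (simp add: P_def N_def)
      qed
      then have triv: "trivial_sf M \<in> J" using B0.trivial_mem by (auto simp: J_def)
      have down: "v \<in> J" if "u \<in> J" "v \<in> B\<^sub>0" "v \<subseteq> u" for u v
        using that by (auto simp: J_def)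
      have "J \<subseteq> B\<^sub>0" by (auto simp: J_def)
      then have "\<exists>F. ultrafilter_in M B\<^sub>0 F \<and> F \<inter> J = {}"
        by (rule B0.ultrafilter_avoiding_ideal[OF _ triv \<open>sets M \<notin> J\<close>])
          (erule (2) down, erule (1) join)
      then obtain F where F: "ultrafilter_in M B\<^sub>0 F" and FJ: "F \<inter> J = {}" by blast
      have FB: "F \<subseteq> B\<^sub>0" and meet: "\<And>u v. u \<in> F \<Longrightarrow> v \<in> F \<Longrightarrow> u \<inter> v \<in> F"
        using F by (auto simp: ultrafilter_in_def)
      have "\<Inter>F \<subseteq> trivial_sf M"
        using atomless F by (auto simp: atomless_sf_algebra_def)
      moreover have "F \<noteq> {}" by (rule B0.ultrafilter_nonempty[OF F])
      ultimately obtain w where w: "w \<in> F" "N w a < e\<^sup>2"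
        using sf_cond_exp_filter_small[of F a 1 "e\<^sup>2"] FB B0.mem_sub_sigma_field meet a(2,3) e
        unfolding N_def by auto
      have "P v" if v: "v \<in> B\<^sub>0" "v \<subseteq> w" for v
      proof -
        have vB: "v \<in> B" "v \<inter> x \<in> B" using v B0(2) x meet_closed by auto
        have "N (v \<inter> x) a \<le> N w a"
          unfolding N_def using vB v w FB B0(2) mem_sub_sigma_field aL2
          by (intro sf_cond_exp_norm_mono) auto
        then have "N (v \<inter> x) a \<le> e\<^sup>2" using w(2) by simp
        then show ?thesis
          unfolding P_def I_def N_def
          by (intro product_pairing_le[OF vB(1) x fL2 e a(1,2) c(1,2)]) simp
      qed
      with w FB FJ show False by (auto simp: J_def)
    qed
    then show ?thesis using B0.full_mem by (simp add: J_def P_def)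
  qed
  have "I (sets M) = 0"
  proof (rule ccontr)
    assume nz: "I (sets M) \<noteq> 0"
    let ?K = "N (sets M) f + N (sets M \<inter> ?x') c"
    have K: "0 \<le> ?K" by (simp add: N_def)
    \<comment> \<open>The choice of \<open>e\<close> makes the bound strictly smaller than \<open>\<bar>I (sets M)\<bar>\<close>.\<close>
    have "\<bar>I (sets M)\<bar> \<le> \<bar>I (sets M)\<bar> / (?K + 1) * ?K"
      using nz K by (intro bound) auto
    then have "\<bar>I (sets M)\<bar> * (?K + 1) \<le> \<bar>I (sets M)\<bar> * ?K"
      using K by (simp add: field_simps)
    then show False using nz by (simp add: distrib_left)
  qed
  moreover have "AE \<omega> in M. sf_cond_exp M (sets M) f \<omega> = f \<omega>"
    using L2_spaceD[OF fL2] mem_sub_sigma_field[OF full_mem]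
    by (intro sf_cond_exp_measurable_eq) (auto simp: measurable_def)
  then have "I (sets M) = expectation (\<lambda>\<omega>. f \<omega> * (a \<omega> * c \<omega>))"
    unfolding I_def by (intro integral_cong_AE) (auto elim: eventually_mono)
  ultimately show ?thesis by simp
qed

lemma atomless_first_chaos_subset:
  assumes B0: "noise_type_boolean_algebra M B\<^sub>0" "B\<^sub>0 \<subseteq> B" and atomless: "atomless_sf_algebra M B\<^sub>0"
  shows "first_chaos M B\<^sub>0 \<subseteq> first_chaos M B"
proof
  interpret B0: noise_type_boolean_algebra M B\<^sub>0 by (rule B0(1))
  fix f assume f: "f \<in> first_chaos M B\<^sub>0"
  note fL2 = B0.first_chaosD(1)[OF f]
  have fint: "integrable M f" using L2_spaceD[OF fL2] by auto
  have "AE \<omega> in M. f \<omega> = sf_cond_exp M x f \<omega> + sf_cond_exp M (sf_complement M B x) f \<omega>"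
    if x: "x \<in> B" for x
  proof -
    let ?x' = "sf_complement M B x"
    have x': "?x' \<in> B" and join: "sf_join M x ?x' = sets M"
      using sf_complement[OF x] by (auto simp: is_sf_complement_def)
    note sx = mem_sub_sigma_field[OF x] and sx' = mem_sub_sigma_field[OF x']
    have "AE \<omega> in M. sf_cond_exp M (sf_join M x ?x') f \<omega>
        = sf_cond_exp M x f \<omega> + sf_cond_exp M ?x' f \<omega>"
    proof (rule sf_cond_exp_add_joinI[OF sx sx'])
      show "sf_join M x ?x' \<in> sub_sigma_fields M"
        using join mem_sub_sigma_field[OF full_mem] by simp
      show "indep_set x ?x'" by (rule complement_indep[OF x])
      show "integrable M f" by (rule fint)
      fix A C assume A: "A \<in> x" and C: "C \<in> ?x'"
      note iA = indicator_sub_sigma_field[OF sx A] and iC = indicator_sub_sigma_field[OF sx' C]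
      have le: "\<bar>indicator D \<omega> - prob D\<bar> \<le> 1" for D \<omega>
      proof -
        have "\<bar>indicator D \<omega> - p\<bar> \<le> 1" if "0 \<le> p" "p \<le> 1" for p :: real
          using that by (auto simp: indicator_def)
        from this[OF measure_nonneg prob_le_1] show ?thesis .
      qed
      have centred: "expectation (\<lambda>\<omega>. indicator D \<omega> - prob D) = 0" if "D \<in> sets M" for D
        using that sets.sets_into_space[OF that]
        by (subst Bochner_Integration.integral_diff)
          (auto simp: Int_absorb2 prob_space less_top[symmetric])
      have zero: "expectation (\<lambda>\<omega>. f \<omega> * ((indicator A \<omega> - prob A) * (indicator C \<omega> - prob C))) = 0"
        by (rule atomless_first_chaos_orthogonal[OF B0 atomless f x _ le centred[OF iA(2)] _ le
              centred[OF iC(2)]])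
          (use iA(1) iC(1) in \<open>auto intro: borel_measurable_diff\<close>)
      have fA: "integrable M (\<lambda>\<omega>. f \<omega> * indicator A \<omega>)"
        and fC: "integrable M (\<lambda>\<omega>. f \<omega> * indicator C \<omega>)"
        using iA(2) iC(2) fint by (auto intro: integrable_real_mult_indicator)
      have fAC: "integrable M (\<lambda>\<omega>. f \<omega> * (indicator A \<omega> * indicator C \<omega>))"
        using integrable_real_mult_indicator[OF iC(2) fA] by (simp add: mult.assoc)
      have "(\<lambda>\<omega>. f \<omega> * ((indicator A \<omega> - prob A) * (indicator C \<omega> - prob C)))
          = (\<lambda>\<omega>. f \<omega> * (indicator A \<omega> * indicator C \<omega>) - f \<omega> * indicator A \<omega> * prob C
              - f \<omega> * indicator C \<omega> * prob A + f \<omega> * (prob A * prob C))"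
        by (auto simp: algebra_simps)
      then show "expectation (\<lambda>\<omega>. f \<omega> * (indicator A \<omega> * indicator C \<omega>))
          = expectation (\<lambda>\<omega>. f \<omega> * indicator A \<omega>) * prob C
            + expectation (\<lambda>\<omega>. f \<omega> * indicator C \<omega>) * prob A"
        using zero fA fC fAC fint B0.first_chaos_trivial(2)[OF f] by simp
    qed
    moreover have "AE \<omega> in M. sf_cond_exp M (sets M) f \<omega> = f \<omega>"
      using fint mem_sub_sigma_field[OF full_mem]
      by (intro sf_cond_exp_measurable_eq) (auto simp: measurable_def)
    ultimately show ?thesis
      unfolding join by eventually_elim simp
  qed
  with fL2 show "f \<in> first_chaos M B" by (auto simp: first_chaos_def)
qed

text \<open>
  Complements in \<open>B\<^sub>0\<close> are also complements in \<open>B\<close>, where they are unique, so \<open>B\<close> imposes all the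
  conditions that \<open>B\<^sub>0\<close> does.
\<close>

lemma first_chaos_antimono:
  assumes B0: "noise_type_boolean_algebra M B\<^sub>0" "B\<^sub>0 \<subseteq> B"
  shows "first_chaos M B \<subseteq> first_chaos M B\<^sub>0"
proof -
  interpret B0: noise_type_boolean_algebra M B\<^sub>0 by (rule B0(1))
  have complement_eq: "sf_complement M B x = sf_complement M B\<^sub>0 x" if "x \<in> B\<^sub>0" for x
    using that B0.sf_complement[OF that] B0(2) by (intro sf_complement_unique) auto
  show ?thesis
  proof
    fix f assume f: "f \<in> first_chaos M B"
    have "AE \<omega> in M. f \<omega> = sf_cond_exp M x f \<omega> + sf_cond_exp M (sf_complement M B\<^sub>0 x) f \<omega>"
      if "x \<in> B\<^sub>0" for x
    proof -
      have "x \<in> B" using that B0(2) by blast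
      from first_chaosD(2)[OF f this] show ?thesis
        unfolding complement_eq[OF that] .
    qed
    with first_chaosD(1)[OF f] show "f \<in> first_chaos M B\<^sub>0"
      by (auto simp: first_chaos_def)
  qed
qed

end

theorem theorem1p13:
  fixes M :: "'a measure" and B\<^sub>0 B :: "'a set set set"
  assumes "prob_space M"
    and "separable_L2 M"
    and "noise_type_boolean_algebra M B\<^sub>0"
    and "noise_type_boolean_algebra M B"
    and "B\<^sub>0 \<subseteq> B"
    and "atomless_sf_algebra M B\<^sub>0"
  shows "sufficient_in M B\<^sub>0 B"
proof -
  interpret noise_type_boolean_algebra M B by (rule assms(4))
  show ?thesis
    unfolding sufficient_in_def
    using atomless_first_chaos_subset[OF assms(3,5,6)] first_chaos_antimono[OF assms(3,5)]
    by (rule equalityI)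
qed

end
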